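(* Let $(M,\in)$ be a countable model of ZFA. Then the membership graph of $M$, keeping double edges, is not $\aleph_0$-categorical. That is, let $\mathcal{G}$ be the first-order structure with domain $M$ and two symmetric binary relations $E$ and $D$, where $E(x,y)$ holds if and only if $M\models x\in y$ or $M\models y\in x$, and $D(x,y)$ holds if and only if $M\models x\in y$ and $M\models y\in x$. Then the complete first-order theory of $\mathcal{G}$ is not $\aleph_0$-categorical.
   Context: ZFA denotes the first-order theory obtained from ZFC (all objects being sets) by deleting the Axiom of Foundation and replacing it by the Anti-Foundation Axiom AFA. AFA states that every flat system of equations has a unique solution. A flat system of equations consists of a set $X$ of indeterminates, a set $A$ of sets called atoms (disjoint from $X$), and, for each $x\in X$, an equation $x=S_x$ with $S_x\subseteq X\cup A$ (the family $(S_x)_{x\in X}$ being itself a set). A solution is an assignment of sets to the indeterminates making all equations true, i.e. a function $s$ with domain $X$ such that $s(x)=\{s(y):y\in S_x\cap X\}\cup(S_x\cap A)$ for all $x\in X$. The membership graph of $M$, keeping double edges, is the undirected multigraph with vertex set $M$ in which distinct $x,y$ are joined by a double edge if both $x\in y$ and $y\in x$, by a single edge if exactly one of $x\in y$, $y\in x$ holds, and by no edge otherwise; $x$ has a loop if $x\in x$. A countable first-order structure is $\aleph_0$-categorical if it is determined up to isomorphism by its first-order theory and the property of countability, i.e. every countable model of its complete first-order theory is isomorphic to it. *)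

theory Defs
  imports "HOL-Library.Countable_Set"
begin

section \<open>First-order logic with equality over binary relational signatures\<close>

text \<open>Variables are de Bruijn indices: in \<open>Exists \<phi>\<close> the index \<open>0\<close> of \<open>\<phi>\<close> is bound, and
  \<open>Suc n\<close> refers to what is variable \<open>n\<close> outside the quantifier.\<close>

datatype 'r fm =
    Rel 'r nat nat
  | Eq nat nat  (infix "\<^bold>=" 70)
  | Neg "'r fm"  ("\<^bold>\<not> _" [68] 68)
  | Conj "'r fm" "'r fm"  (infixr "\<^bold>\<and>" 62)
  | Exists "'r fm"

definition Disj :: "'r fm \<Rightarrow> 'r fm \<Rightarrow> 'r fm"  (infixr "\<^bold>\<or>" 58)
  where "\<phi> \<^bold>\<or> \<psi> = Neg (Conj (Neg \<phi>) (Neg \<psi>))"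

definition Imp :: "'r fm \<Rightarrow> 'r fm \<Rightarrow> 'r fm"  (infixr "\<^bold>\<longrightarrow>" 54)
  where "\<phi> \<^bold>\<longrightarrow> \<psi> = Neg (Conj \<phi> (Neg \<psi>))"

definition Iff :: "'r fm \<Rightarrow> 'r fm \<Rightarrow> 'r fm"  (infix "\<^bold>\<longleftrightarrow>" 54)
  where "\<phi> \<^bold>\<longleftrightarrow> \<psi> = Conj (Imp \<phi> \<psi>) (Imp \<psi> \<phi>)"

definition Forall :: "'r fm \<Rightarrow> 'r fm"
  where "Forall \<phi> = Neg (Exists (Neg \<phi>))"

primrec fv :: "'r fm \<Rightarrow> nat set" where
  "fv (Rel r i j) = {i, j}"
| "fv (Eq i j) = {i, j}"
| "fv (Neg \<phi>) = fv \<phi>"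
| "fv (Conj \<phi> \<psi>) = fv \<phi> \<union> fv \<psi>"
| "fv (Exists \<phi>) = {n. Suc n \<in> fv \<phi>}"

definition sentence :: "'r fm \<Rightarrow> bool"
  where "sentence \<phi> \<longleftrightarrow> fv \<phi> = {}"

primrec rename :: "(nat \<Rightarrow> nat) \<Rightarrow> 'r fm \<Rightarrow> 'r fm" where
  "rename f (Rel r i j) = Rel r (f i) (f j)"
| "rename f (Eq i j) = Eq (f i) (f j)"
| "rename f (Neg \<phi>) = Neg (rename f \<phi>)"
| "rename f (Conj \<phi> \<psi>) = Conj (rename f \<phi>) (rename f \<psi>)"
| "rename f (Exists \<phi>) = Exists (rename (case_nat 0 (\<lambda>n. Suc (f n))) \<phi>)"

record ('r, 'a) rel_struct =
  universe :: "'a set"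
  interp :: "'r \<Rightarrow> 'a \<Rightarrow> 'a \<Rightarrow> bool"

primrec sat :: "('r, 'a) rel_struct \<Rightarrow> (nat \<Rightarrow> 'a) \<Rightarrow> 'r fm \<Rightarrow> bool" where
  "sat M e (Rel r i j) \<longleftrightarrow> interp M r (e i) (e j)"
| "sat M e (Eq i j) \<longleftrightarrow> e i = e j"
| "sat M e (Neg \<phi>) \<longleftrightarrow> \<not> sat M e \<phi>"
| "sat M e (Conj \<phi> \<psi>) \<longleftrightarrow> sat M e \<phi> \<and> sat M e \<psi>"
| "sat M e (Exists \<phi>) \<longleftrightarrow> (\<exists>a \<in> universe M. sat M (case_nat a e) \<phi>)"

text \<open>A formula with free variables is identified with its universal closure.\<close>

definition valid :: "('r, 'a) rel_struct \<Rightarrow> 'r fm \<Rightarrow> bool"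
  where "valid M \<phi> \<longleftrightarrow> (\<forall>e. range e \<subseteq> universe M \<longrightarrow> sat M e \<phi>)"

definition models :: "('r, 'a) rel_struct \<Rightarrow> 'r fm set \<Rightarrow> bool"  (infix "\<Turnstile>" 50)
  where "M \<Turnstile> T \<longleftrightarrow> universe M \<noteq> {} \<and> (\<forall>\<phi> \<in> T. valid M \<phi>)"

definition complete_theory :: "('r, 'a) rel_struct \<Rightarrow> 'r fm set"
  where "complete_theory M = {\<phi>. sentence \<phi> \<and> valid M \<phi>}"

definition isomorphic :: "('r, 'a) rel_struct \<Rightarrow> ('r, 'b) rel_struct \<Rightarrow> bool"
  where "isomorphic M N \<longleftrightarrow> (\<exists>f. bij_betw f (universe M) (universe N) \<and>
    (\<forall>r. \<forall>x \<in> universe M. \<forall>y \<in> universe M. interp M r x y \<longleftrightarrow> interp N r (f x) (f y)))"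

text \<open>Up to isomorphism, the countable structures are those whose universe is a set of natural
  numbers, so it suffices to quantify over these; \<open>aleph0_categoricalD\<close> below confirms that
  countable models on any other type are covered.\<close>

definition aleph0_categorical :: "('r, 'a) rel_struct \<Rightarrow> bool"
  where "aleph0_categorical M \<longleftrightarrow> countable (universe M) \<and>
    (\<forall>N :: ('r, nat) rel_struct. N \<Turnstile> complete_theory M \<longrightarrow> isomorphic N M)"

lemma sat_connectives [simp]:
  "sat M e (\<phi> \<^bold>\<or> \<psi>) \<longleftrightarrow> sat M e \<phi> \<or> sat M e \<psi>"
  "sat M e (\<phi> \<^bold>\<longrightarrow> \<psi>) \<longleftrightarrow> (sat M e \<phi> \<longrightarrow> sat M e \<psi>)"
  "sat M e (\<phi> \<^bold>\<longleftrightarrow> \<psi>) \<longleftrightarrow> (sat M e \<phi> \<longleftrightarrow> sat M e \<psi>)"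
  "sat M e (Forall \<phi>) \<longleftrightarrow> (\<forall>a \<in> universe M. sat M (case_nat a e) \<phi>)"
  by (auto simp: Disj_def Imp_def Iff_def Forall_def)

lemma sat_rename [simp]: "sat M e (rename f \<phi>) \<longleftrightarrow> sat M (\<lambda>n. e (f n)) \<phi>"
proof (induction \<phi> arbitrary: f e)
  case (Exists \<phi>)
  have "(\<lambda>n. case_nat a e (case_nat 0 (\<lambda>n. Suc (f n)) n)) = case_nat a (\<lambda>n. e (f n))" for a
    by (auto split: nat.split)
  then show ?case by (simp add: Exists)
qed auto

lemma sat_iso:
  assumes f: "bij_betw f (universe M) (universe N)"
    and r: "\<And>r x y. x \<in> universe M \<Longrightarrow> y \<in> universe M \<Longrightarrow> interp M r x y \<longleftrightarrow> interp N r (f x) (f y)"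
    and "range e \<subseteq> universe M"
  shows "sat M e \<phi> \<longleftrightarrow> sat N (\<lambda>n. f (e n)) \<phi>"
  using assms(3)
proof (induction \<phi> arbitrary: e)
  case (Rel r' i j)
  then have "e i \<in> universe M" "e j \<in> universe M" by auto
  then show ?case using r by simp
next
  case (Eq i j)
  then have "e i \<in> universe M" "e j \<in> universe M" by auto
  then show ?case using f by (auto simp: bij_betw_def inj_on_def)
next
  case (Exists \<phi>)
  have "(\<lambda>n. f (case_nat a e n)) = case_nat (f a) (\<lambda>n. f (e n))" for a
    by (auto split: nat.split)
  moreover have "range (case_nat a e) \<subseteq> universe M" if "a \<in> universe M" for a
    using that Exists.prems by (auto simp: image_subset_iff split: nat.split)
  ultimately have "sat M (case_nat a e) \<phi> \<longleftrightarrow> sat N (case_nat (f a) (\<lambda>n. f (e n))) \<phi>"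
    if "a \<in> universe M" for a
    using that Exists.IH by metis
  moreover have "universe N = f ` universe M"
    using f by (auto simp: bij_betw_def)
  ultimately show ?case by auto
qed auto

lemma isomorphic_sym: "isomorphic M N \<Longrightarrow> isomorphic N M"
  unfolding isomorphic_def
proof (elim exE conjE)
  fix f
  assume f: "bij_betw f (universe M) (universe N)"
    and r: "\<forall>r. \<forall>x\<in>universe M. \<forall>y\<in>universe M. interp M r x y = interp N r (f x) (f y)"
  let ?g = "the_inv_into (universe M) f"
  have g: "bij_betw ?g (universe N) (universe M)"
    using f by (rule bij_betw_the_inv_into)
  have "interp N r x y = interp M r (?g x) (?g y)"
    if "x \<in> universe N" "y \<in> universe N" for r x y
    using that r f g f_the_inv_into_f_bij_betw[OF f] by (auto simp: bij_betw_apply)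
  with g show "\<exists>f. bij_betw f (universe N) (universe M) \<and>
    (\<forall>r. \<forall>x\<in>universe N. \<forall>y\<in>universe N. interp N r x y = interp M r (f x) (f y))"
    by blast
qed

lemma isomorphic_trans: "isomorphic M N \<Longrightarrow> isomorphic N K \<Longrightarrow> isomorphic M K"
  unfolding isomorphic_def
proof (elim exE conjE)
  fix f g
  assume f: "bij_betw f (universe M) (universe N)"
    and rf: "\<forall>r. \<forall>x\<in>universe M. \<forall>y\<in>universe M. interp M r x y = interp N r (f x) (f y)"
    and g: "bij_betw g (universe N) (universe K)"
    and rg: "\<forall>r. \<forall>x\<in>universe N. \<forall>y\<in>universe N. interp N r x y = interp K r (g x) (g y)"
  have "bij_betw (g \<circ> f) (universe M) (universe K)"
    using f g by (rule bij_betw_trans)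
  moreover have "\<forall>r. \<forall>x\<in>universe M. \<forall>y\<in>universe M. interp M r x y = interp K r ((g \<circ> f) x) ((g \<circ> f) y)"
    using rf rg f by (auto simp: bij_betw_apply)
  ultimately show "\<exists>f. bij_betw f (universe M) (universe K) \<and>
    (\<forall>r. \<forall>x\<in>universe M. \<forall>y\<in>universe M. interp M r x y = interp K r (f x) (f y))"
    by blast
qed

lemma models_iso:
  assumes "isomorphic M N" "N \<Turnstile> T"
  shows "M \<Turnstile> T"
proof -
  obtain f where f: "bij_betw f (universe M) (universe N)"
    and r: "\<And>r x y. x \<in> universe M \<Longrightarrow> y \<in> universe M \<Longrightarrow> interp M r x y \<longleftrightarrow> interp N r (f x) (f y)"
    using assms(1) unfolding isomorphic_def by blast
  have "sat M e \<phi>" if "range e \<subseteq> universe M" "\<phi> \<in> T" for e \<phi>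
  proof -
    have "range (\<lambda>n. f (e n)) \<subseteq> universe N"
      using that f by (auto simp: bij_betw_apply subset_iff)
    then show ?thesis
      using sat_iso[OF f r that(1)] assms(2) that(2) by (auto simp: models_def valid_def)
  qed
  moreover have "universe M \<noteq> {}"
    using f assms(2) by (auto simp: models_def bij_betw_def)
  ultimately show ?thesis by (auto simp: models_def valid_def)
qed

lemma aleph0_categoricalD:
  assumes M: "aleph0_categorical M" and N: "N \<Turnstile> complete_theory M" "countable (universe N)"
  shows "isomorphic N M"
proof -
  let ?f = "to_nat_on (universe N)" and ?g = "from_nat_into (universe N)"
  let ?N' = "\<lparr>universe = ?f ` universe N, interp = (\<lambda>r x y. interp N r (?g x) (?g y))\<rparr>"
  have "bij_betw ?f (universe N) (universe ?N')"
    using inj_on_to_nat_on[OF N(2)] by (simp add: bij_betw_def)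
  then have iso: "isomorphic N ?N'"
    unfolding isomorphic_def by (intro exI[of _ ?f] conjI) (simp_all add: N(2))
  then have "isomorphic ?N' M"
    using M models_iso[OF isomorphic_sym[OF iso] N(1)] by (auto simp: aleph0_categorical_def)
  with iso show ?thesis by (rule isomorphic_trans)
qed


section \<open>The theory ZFA\<close>

datatype set_sym = In

abbreviation Mem :: "nat \<Rightarrow> nat \<Rightarrow> set_sym fm"  (infix "\<^bold>\<in>" 70)
  where "x \<^bold>\<in> y \<equiv> Rel In x y"

abbreviation mem :: "(set_sym, 'a) rel_struct \<Rightarrow> 'a \<Rightarrow> 'a \<Rightarrow> bool"
  where "mem M \<equiv> interp M In"

definition Extensionality_ax :: "set_sym fm" where
  "Extensionality_ax = Forall (Forall (Forall (0 \<^bold>\<in> 2 \<^bold>\<longleftrightarrow> 0 \<^bold>\<in> 1) \<^bold>\<longrightarrow> 1 \<^bold>= 0))"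

definition upair_fm :: "nat \<Rightarrow> nat \<Rightarrow> nat \<Rightarrow> set_sym fm" where
  "upair_fm x y z = Forall (0 \<^bold>\<in> (z+1) \<^bold>\<longleftrightarrow> 0 \<^bold>= (x+1) \<^bold>\<or> 0 \<^bold>= (y+1))"

definition Pairing_ax :: "set_sym fm" where
  "Pairing_ax = Forall (Forall (Exists (upair_fm 2 1 0)))"

definition Union_ax :: "set_sym fm" where
  "Union_ax = Forall (Exists (Forall (0 \<^bold>\<in> 1 \<^bold>\<longleftrightarrow> Exists (1 \<^bold>\<in> 0 \<^bold>\<and> 0 \<^bold>\<in> 3))))"

definition Power_ax :: "set_sym fm" where
  "Power_ax = Forall (Exists (Forall (0 \<^bold>\<in> 1 \<^bold>\<longleftrightarrow> Forall (0 \<^bold>\<in> 1 \<^bold>\<longrightarrow> 0 \<^bold>\<in> 3))))"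

definition Infinity_ax :: "set_sym fm" where
  "Infinity_ax = Exists (
     Exists (0 \<^bold>\<in> 1 \<^bold>\<and> Forall (\<^bold>\<not> (0 \<^bold>\<in> 1))) \<^bold>\<and>
     Forall (0 \<^bold>\<in> 1 \<^bold>\<longrightarrow>
       Exists (0 \<^bold>\<in> 2 \<^bold>\<and> Forall (0 \<^bold>\<in> 1 \<^bold>\<longleftrightarrow> 0 \<^bold>\<in> 2 \<^bold>\<or> 0 \<^bold>= 2))))"

text \<open>In the two schemas the renamings make room for the quantifiers of the axiom. For Separation,
  variable \<open>0\<close> of \<open>\<phi>\<close> is the element and \<open>n + 1\<close> is parameter \<open>n\<close>. For Replacement, \<open>0\<close> is the
  value, \<open>1\<close> the argument and \<open>n + 2\<close> parameter \<open>n\<close>.\<close>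

definition Separation_ax :: "set_sym fm \<Rightarrow> set_sym fm" where
  "Separation_ax \<phi> =
     Forall (Exists (Forall (0 \<^bold>\<in> 1 \<^bold>\<longleftrightarrow> 0 \<^bold>\<in> 2 \<^bold>\<and> rename (case_nat 0 (\<lambda>n. n+3)) \<phi>)))"

definition Replacement_ax :: "set_sym fm \<Rightarrow> set_sym fm" where
  "Replacement_ax \<phi> = Forall (
     Forall (0 \<^bold>\<in> 1 \<^bold>\<longrightarrow> Forall (Forall (
       rename (case_nat 1 (case_nat 2 (\<lambda>n. n+4))) \<phi> \<^bold>\<and>
       rename (case_nat 0 (case_nat 2 (\<lambda>n. n+4))) \<phi> \<^bold>\<longrightarrow> 1 \<^bold>= 0))) \<^bold>\<longrightarrow>
     Exists (Forall (0 \<^bold>\<in> 1 \<^bold>\<longleftrightarrow>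
       Exists (0 \<^bold>\<in> 3 \<^bold>\<and> rename (case_nat 1 (case_nat 0 (\<lambda>n. n+4))) \<phi>))))"

text \<open>Choice: every set of nonempty, pairwise disjoint sets has a transversal.\<close>

definition Choice_ax :: "set_sym fm" where
  "Choice_ax = Forall (
     Forall (0 \<^bold>\<in> 1 \<^bold>\<longrightarrow> Exists (0 \<^bold>\<in> 1)) \<^bold>\<and>
     Forall (Forall (1 \<^bold>\<in> 2 \<^bold>\<and> 0 \<^bold>\<in> 2 \<^bold>\<and> Exists (0 \<^bold>\<in> 2 \<^bold>\<and> 0 \<^bold>\<in> 1) \<^bold>\<longrightarrow> 1 \<^bold>= 0)) \<^bold>\<longrightarrow>
     Exists (Forall (0 \<^bold>\<in> 2 \<^bold>\<longrightarrow>
       Exists (Forall (0 \<^bold>\<in> 2 \<^bold>\<and> 0 \<^bold>\<in> 3 \<^bold>\<longleftrightarrow> 0 \<^bold>= 1)))))"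

text \<open>Functions are sets of Kuratowski pairs.\<close>

definition pair_fm :: "nat \<Rightarrow> nat \<Rightarrow> nat \<Rightarrow> set_sym fm" where
  "pair_fm x y p =
     Exists (Exists (upair_fm (x+2) (x+2) 1 \<^bold>\<and> upair_fm (x+2) (y+2) 0 \<^bold>\<and> upair_fm 1 0 (p+2)))"

definition app_fm :: "nat \<Rightarrow> nat \<Rightarrow> nat \<Rightarrow> set_sym fm" where
  "app_fm f x y = Exists (0 \<^bold>\<in> (f+1) \<^bold>\<and> pair_fm (x+1) (y+1) 0)"

definition fun_fm :: "nat \<Rightarrow> nat \<Rightarrow> set_sym fm" where
  "fun_fm f d =
     Forall (0 \<^bold>\<in> (f+1) \<^bold>\<longrightarrow> Exists (Exists (1 \<^bold>\<in> (d+3) \<^bold>\<and> pair_fm 1 0 2))) \<^bold>\<and>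
     Forall (0 \<^bold>\<in> (d+1) \<^bold>\<longrightarrow> Exists (Forall (app_fm (f+3) 2 0 \<^bold>\<longleftrightarrow> 0 \<^bold>= 1)))"

definition flat_system_fm :: "nat \<Rightarrow> nat \<Rightarrow> nat \<Rightarrow> set_sym fm" where
  "flat_system_fm X A S =
     \<^bold>\<not> Exists (0 \<^bold>\<in> (X+1) \<^bold>\<and> 0 \<^bold>\<in> (A+1)) \<^bold>\<and>
     fun_fm S X \<^bold>\<and>
     Forall (Forall (1 \<^bold>\<in> (X+2) \<^bold>\<and> app_fm (S+2) 1 0 \<^bold>\<longrightarrow>
       Forall (0 \<^bold>\<in> 1 \<^bold>\<longrightarrow> 0 \<^bold>\<in> (X+3) \<^bold>\<or> 0 \<^bold>\<in> (A+3))))"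

definition solution_fm :: "nat \<Rightarrow> nat \<Rightarrow> nat \<Rightarrow> nat \<Rightarrow> set_sym fm" where
  "solution_fm s X A S =
     fun_fm s X \<^bold>\<and>
     Forall (Forall (Forall (2 \<^bold>\<in> (X+3) \<^bold>\<and> app_fm (S+3) 2 1 \<^bold>\<and> app_fm (s+3) 2 0 \<^bold>\<longrightarrow>
       Forall (0 \<^bold>\<in> 1 \<^bold>\<longleftrightarrow>
         Exists (0 \<^bold>\<in> 3 \<^bold>\<and> 0 \<^bold>\<in> (X+5) \<^bold>\<and> app_fm (s+5) 0 1) \<^bold>\<or> 0 \<^bold>\<in> 2 \<^bold>\<and> 0 \<^bold>\<in> (A+4)))))"

definition AFA_ax :: "set_sym fm" where
  "AFA_ax = Forall (Forall (Forall (flat_system_fm 2 1 0 \<^bold>\<longrightarrow>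
     Exists (Forall (solution_fm 0 4 3 2 \<^bold>\<longleftrightarrow> 0 \<^bold>= 1)))))"

definition ZFA :: "set_sym fm set" where
  "ZFA = {Extensionality_ax, Pairing_ax, Union_ax, Power_ax, Infinity_ax, Choice_ax, AFA_ax}
     \<union> range Separation_ax \<union> range Replacement_ax"

text \<open>The following facts spell out the de Bruijn formulas above as statements relativised to \<open>M\<close>.\<close>

definition is_upair :: "(set_sym, 'a) rel_struct \<Rightarrow> 'a \<Rightarrow> 'a \<Rightarrow> 'a \<Rightarrow> bool" where
  "is_upair M x y z \<longleftrightarrow> (\<forall>w \<in> universe M. mem M w z \<longleftrightarrow> w = x \<or> w = y)"

definition is_pair :: "(set_sym, 'a) rel_struct \<Rightarrow> 'a \<Rightarrow> 'a \<Rightarrow> 'a \<Rightarrow> bool" where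
  "is_pair M x y p \<longleftrightarrow>
     (\<exists>u \<in> universe M. \<exists>v \<in> universe M. is_upair M x x u \<and> is_upair M x y v \<and> is_upair M u v p)"

definition is_app :: "(set_sym, 'a) rel_struct \<Rightarrow> 'a \<Rightarrow> 'a \<Rightarrow> 'a \<Rightarrow> bool" where
  "is_app M f x y \<longleftrightarrow> (\<exists>p \<in> universe M. mem M p f \<and> is_pair M x y p)"

definition is_fun :: "(set_sym, 'a) rel_struct \<Rightarrow> 'a \<Rightarrow> 'a \<Rightarrow> bool" where
  "is_fun M f d \<longleftrightarrow>
     (\<forall>p \<in> universe M. mem M p f \<longrightarrow>
       (\<exists>x \<in> universe M. \<exists>y \<in> universe M. mem M x d \<and> is_pair M x y p)) \<and>
     (\<forall>x \<in> universe M. mem M x d \<longrightarrow> (\<exists>!y. y \<in> universe M \<and> is_app M f x y))"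

definition is_flat_system :: "(set_sym, 'a) rel_struct \<Rightarrow> 'a \<Rightarrow> 'a \<Rightarrow> 'a \<Rightarrow> bool" where
  "is_flat_system M X A S \<longleftrightarrow>
     \<not> (\<exists>z \<in> universe M. mem M z X \<and> mem M z A) \<and>
     is_fun M S X \<and>
     (\<forall>x \<in> universe M. \<forall>t \<in> universe M. mem M x X \<and> is_app M S x t \<longrightarrow>
       (\<forall>z \<in> universe M. mem M z t \<longrightarrow> mem M z X \<or> mem M z A))"

definition is_solution :: "(set_sym, 'a) rel_struct \<Rightarrow> 'a \<Rightarrow> 'a \<Rightarrow> 'a \<Rightarrow> 'a \<Rightarrow> bool" where
  "is_solution M s X A S \<longleftrightarrow>
     is_fun M s X \<and>
     (\<forall>x \<in> universe M. \<forall>t \<in> universe M. \<forall>v \<in> universe M.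
       mem M x X \<and> is_app M S x t \<and> is_app M s x v \<longrightarrow>
       (\<forall>w \<in> universe M. mem M w v \<longleftrightarrow>
         (\<exists>y \<in> universe M. mem M y t \<and> mem M y X \<and> is_app M s y w) \<or> mem M w t \<and> mem M w A))"

lemma Ex1_iff_eq: "(\<exists>y \<in> U. \<forall>z \<in> U. P z \<longleftrightarrow> z = y) \<longleftrightarrow> (\<exists>!y. y \<in> U \<and> P y)"
  by (auto simp: Ex1_def)

lemma sat_upair_fm [simp]: "sat M e (upair_fm x y z) \<longleftrightarrow> is_upair M (e x) (e y) (e z)"
  by (simp add: upair_fm_def is_upair_def)

lemma sat_pair_fm [simp]: "sat M e (pair_fm x y p) \<longleftrightarrow> is_pair M (e x) (e y) (e p)"
  by (simp add: pair_fm_def is_pair_def)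

lemma sat_app_fm [simp]: "sat M e (app_fm f x y) \<longleftrightarrow> is_app M (e f) (e x) (e y)"
  by (simp add: app_fm_def is_app_def)

lemma sat_fun_fm [simp]: "sat M e (fun_fm f d) \<longleftrightarrow> is_fun M (e f) (e d)"
  by (simp add: fun_fm_def is_fun_def eval_nat_numeral Ex1_iff_eq)

lemma sat_flat_system_fm [simp]:
  "sat M e (flat_system_fm X A S) \<longleftrightarrow> is_flat_system M (e X) (e A) (e S)"
  by (simp add: flat_system_fm_def is_flat_system_def eval_nat_numeral)

lemma sat_solution_fm [simp]:
  "sat M e (solution_fm s X A S) \<longleftrightarrow> is_solution M (e s) (e X) (e A) (e S)"
  by (simp add: solution_fm_def is_solution_def eval_nat_numeral)

lemma sat_AFA_ax:
  "sat M e AFA_ax \<longleftrightarrow>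
     (\<forall>X \<in> universe M. \<forall>A \<in> universe M. \<forall>S \<in> universe M. is_flat_system M X A S \<longrightarrow>
       (\<exists>!s. s \<in> universe M \<and> is_solution M s X A S))"
  by (simp add: AFA_ax_def eval_nat_numeral Ex1_iff_eq)

lemma sat_Extensionality_ax:
  "sat M e Extensionality_ax \<longleftrightarrow>
     (\<forall>x \<in> universe M. \<forall>y \<in> universe M. (\<forall>z \<in> universe M. mem M z x \<longleftrightarrow> mem M z y) \<longrightarrow> x = y)"
  by (simp add: Extensionality_ax_def eval_nat_numeral)

lemma sat_Pairing_ax:
  "sat M e Pairing_ax \<longleftrightarrow>
     (\<forall>x \<in> universe M. \<forall>y \<in> universe M. \<exists>z \<in> universe M. is_upair M x y z)"
  by (simp add: Pairing_ax_def eval_nat_numeral)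

lemma sat_Union_ax:
  "sat M e Union_ax \<longleftrightarrow>
     (\<forall>a \<in> universe M. \<exists>u \<in> universe M. \<forall>x \<in> universe M.
       mem M x u \<longleftrightarrow> (\<exists>y \<in> universe M. mem M x y \<and> mem M y a))"
  by (simp add: Union_ax_def eval_nat_numeral)

lemma sat_Power_ax:
  "sat M e Power_ax \<longleftrightarrow>
     (\<forall>a \<in> universe M. \<exists>p \<in> universe M. \<forall>x \<in> universe M.
       mem M x p \<longleftrightarrow> (\<forall>z \<in> universe M. mem M z x \<longrightarrow> mem M z a))"
  by (simp add: Power_ax_def eval_nat_numeral)

lemma sat_Infinity_ax:
  "sat M e Infinity_ax \<longleftrightarrow>
     (\<exists>i \<in> universe M.
       (\<exists>z \<in> universe M. mem M z i \<and> (\<forall>w \<in> universe M. \<not> mem M w z)) \<and>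
       (\<forall>x \<in> universe M. mem M x i \<longrightarrow>
         (\<exists>y \<in> universe M. mem M y i \<and> (\<forall>w \<in> universe M. mem M w y \<longleftrightarrow> mem M w x \<or> w = x))))"
  by (simp add: Infinity_ax_def eval_nat_numeral)

lemma sat_Choice_ax:
  "sat M e Choice_ax \<longleftrightarrow>
     (\<forall>a \<in> universe M.
       (\<forall>x \<in> universe M. mem M x a \<longrightarrow> (\<exists>z \<in> universe M. mem M z x)) \<and>
       (\<forall>x \<in> universe M. \<forall>y \<in> universe M. mem M x a \<and> mem M y a \<and>
         (\<exists>z \<in> universe M. mem M z x \<and> mem M z y) \<longrightarrow> x = y) \<longrightarrow>
       (\<exists>c \<in> universe M. \<forall>x \<in> universe M. mem M x a \<longrightarrow>
         (\<exists>!z. z \<in> universe M \<and> mem M z x \<and> mem M z c)))"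
  by (simp add: Choice_ax_def eval_nat_numeral Ex1_iff_eq)

lemma sat_Separation_ax:
  "sat M e (Separation_ax \<phi>) \<longleftrightarrow>
     (\<forall>a \<in> universe M. \<exists>b \<in> universe M. \<forall>x \<in> universe M.
       mem M x b \<longleftrightarrow> mem M x a \<and> sat M (case_nat x e) \<phi>)"
proof -
  have "sat M (case_nat x (case_nat b (case_nat a e))) (rename (case_nat 0 (\<lambda>n. n+3)) \<phi>)
      \<longleftrightarrow> sat M (case_nat x e) \<phi>" for x b a
    unfolding sat_rename by (rule arg_cong[where f = "\<lambda>e. sat M e \<phi>"])
      (auto simp: eval_nat_numeral split: nat.split)
  then show ?thesis by (simp add: Separation_ax_def del: sat_rename)
qed

lemma sat_Replacement_ax:
  "sat M e (Replacement_ax \<phi>) \<longleftrightarrow>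
     (\<forall>a \<in> universe M.
       (\<forall>x \<in> universe M. mem M x a \<longrightarrow> (\<forall>y \<in> universe M. \<forall>z \<in> universe M.
         sat M (case_nat y (case_nat x e)) \<phi> \<and> sat M (case_nat z (case_nat x e)) \<phi> \<longrightarrow> y = z)) \<longrightarrow>
       (\<exists>b \<in> universe M. \<forall>y \<in> universe M. mem M y b \<longleftrightarrow>
         (\<exists>x \<in> universe M. mem M x a \<and> sat M (case_nat y (case_nat x e)) \<phi>)))"
proof -
  have "sat M (case_nat z (case_nat y (case_nat x (case_nat a e))))
       (rename (case_nat (Suc 0) (case_nat 2 (\<lambda>n. n+4))) \<phi>) \<longleftrightarrow> sat M (case_nat y (case_nat x e)) \<phi>"
    "sat M (case_nat z (case_nat y (case_nat x (case_nat a e))))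
       (rename (case_nat 0 (case_nat 2 (\<lambda>n. n+4))) \<phi>) \<longleftrightarrow> sat M (case_nat z (case_nat x e)) \<phi>"
    "sat M (case_nat z (case_nat y (case_nat x (case_nat a e))))
       (rename (case_nat (Suc 0) (case_nat 0 (\<lambda>n. n+4))) \<phi>) \<longleftrightarrow> sat M (case_nat y (case_nat z e)) \<phi>" for z y x a
    unfolding sat_rename by (rule arg_cong[where f = "\<lambda>e. sat M e \<phi>"],
      simp add: fun_eq_iff eval_nat_numeral split: nat.split)+
  then show ?thesis by (simp add: Replacement_ax_def del: sat_rename)
qed


section \<open>The membership graph, keeping double edges\<close>

datatype graph_sym = E | D

definition membership_graph :: "(set_sym, 'a) rel_struct \<Rightarrow> (graph_sym, 'a) rel_struct" where
  "membership_graph M = \<lparr>universe = universe M,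
     interp = (\<lambda>r x y. case r of
         E \<Rightarrow> mem M x y \<or> mem M y x
       | D \<Rightarrow> mem M x y \<and> mem M y x)\<rparr>"

end

(* By AFA, every n is the number of double-edge neighbours of some vertex, so these vertices have
   infinitely many types and a limit of these types is not isolated. A Henkin construction
   gives a countable model of the theory realising the limit type and another one omitting it. *)

theory Submission imports Defs begin

text \<open>Having infinitely many double neighbours is only a partial type, which vertices with
  isolated types may realise, so omitting it may be impossible. The omitted type is therefore a
  completion of it in which every formula is required to hold at infinitely many of the chosen
  vertices; this property rules out isolation. Such a completion is built generically, deciding one
  formula at a time, because an infinite set split in two keeps an infinite half. The omitting model
  comes from the same construction with a weaker notion of allowed condition, mere satisfiability.
  Under categoricity both models are copies of the given graph, where the type would be both
  realised and omitted. Neighbours are counted by \<open>D\<close> because every set belongs to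
  infinitely many sets, which makes all degrees in \<open>E\<close> infinite.\<close>

section \<open>Henkin sets of formulas\<close>

instance fm :: (countable) countable
  by countable_datatype

instance graph_sym :: countable
  by countable_datatype

lemma finite_fv [simp]: "finite (fv \<phi>)"
proof (induction \<phi>)
  case (Exists \<phi>)
  have "finite (Suc -` fv \<phi>)"
    using Exists by (intro finite_vimageI) auto
  then show ?case by (simp add: vimage_def)
qed auto

lemma sat_fv_cong:
  "(\<And>n. n \<in> fv \<phi> \<Longrightarrow> e n = e' n) \<Longrightarrow> sat M e \<phi> \<longleftrightarrow> sat M e' \<phi>"
proof (induction \<phi> arbitrary: e e')
  case (Neg \<phi>)
  have "sat M e \<phi> \<longleftrightarrow> sat M e' \<phi>" by (rule Neg.IH) (simp add: Neg.prems)
  then show ?case by simp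
next
  case (Conj \<phi> \<psi>)
  have "sat M e \<phi> \<longleftrightarrow> sat M e' \<phi>" by (rule Conj.IH) (simp add: Conj.prems)
  moreover have "sat M e \<psi> \<longleftrightarrow> sat M e' \<psi>" by (rule Conj.IH) (simp add: Conj.prems)
  ultimately show ?case by simp
next
  case (Exists \<phi>)
  have "sat M (case_nat a e) \<phi> \<longleftrightarrow> sat M (case_nat a e') \<phi>" for a
    by (rule Exists.IH) (use Exists.prems in \<open>auto split: nat.split\<close>)
  then show ?case by simp
qed auto

text \<open>The Rasiowa-Sikorski argument: formulas satisfying \<open>P\<close> are the conditions,
  conjunction extends them, and each \<open>R\<close> is a requirement to be met by conjoining one
  of its members. Dependent choice builds a chain; \<open>\<Delta>\<close> collects the conjoined
  formulas, and a late enough condition implies any finitely many of them.\<close>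

lemma generic_set:
  assumes P: "P \<theta>0" and R: "countable \<R>"
    and dense: "\<And>\<theta> R. P \<theta> \<Longrightarrow> R \<in> \<R> \<Longrightarrow> \<exists>\<psi>\<in>R. P (\<theta> \<^bold>\<and> \<psi>)"
  obtains \<Delta> where "\<And>R. R \<in> \<R> \<Longrightarrow> R \<inter> \<Delta> \<noteq> {}"
    and "\<And>F. finite F \<Longrightarrow> F \<subseteq> \<Delta> \<Longrightarrow> \<exists>\<theta>. P \<theta> \<and> (\<forall>e. sat M e \<theta> \<longrightarrow> (\<forall>\<psi>\<in>F. sat M e \<psi>))"
proof (cases "\<R> = {}")
  case True
  with P show ?thesis by (intro that[of "{}"]) auto
next
  case False
  let ?R = "from_nat_into \<R>"
  have "\<exists>\<theta>. \<forall>k. P (\<theta> k) \<and> (\<exists>\<psi>\<in>?R k. \<theta> (Suc k) = \<theta> k \<^bold>\<and> \<psi>)"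
    using P dense from_nat_into[OF False]
    by (intro dependent_nat_choice[where P = "\<lambda>_. P" and Q = "\<lambda>k \<theta> \<theta>'. \<exists>\<psi>\<in>?R k. \<theta>' = \<theta> \<^bold>\<and> \<psi>"]) blast+
  then obtain \<theta> where \<theta>: "\<And>k. P (\<theta> k)" and step: "\<And>k. \<exists>\<psi>\<in>?R k. \<theta> (Suc k) = \<theta> k \<^bold>\<and> \<psi>"
    by blast
  from step obtain \<psi> where \<psi>: "\<And>k. \<psi> k \<in> ?R k" "\<And>k. \<theta> (Suc k) = \<theta> k \<^bold>\<and> \<psi> k"
    by metis
  have imp: "sat M e (\<theta> n) \<Longrightarrow> k < n \<Longrightarrow> sat M e (\<psi> k)" for e k n
    by (induction n) (auto simp: \<psi>(2) less_Suc_eq)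
  show ?thesis
  proof (rule that[of "range \<psi>"])
    fix R' assume "R' \<in> \<R>"
    then obtain k where "?R k = R'" using from_nat_into_surj[OF R] by blast
    then show "R' \<inter> range \<psi> \<noteq> {}" using \<psi>(1)[of k] by auto
  next
    fix F assume "finite F" "F \<subseteq> range \<psi>"
    then obtain K where K: "finite K" "F = \<psi> ` K" by (meson finite_subset_image)
    then obtain n where "\<forall>k\<in>K. k < n" using finite_nat_set_iff_bounded by auto
    with K have "\<forall>e. sat M e (\<theta> n) \<longrightarrow> (\<forall>\<psi>\<in>F. sat M e \<psi>)" using imp by auto
    with \<theta> show "\<exists>\<theta>. P \<theta> \<and> (\<forall>e. sat M e \<theta> \<longrightarrow> (\<forall>\<psi>\<in>F. sat M e \<psi>))" by blast
  qed
qed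

text \<open>The variables themselves serve as Henkin constants.\<close>

lemma henkin_model:
  fixes M :: "('r, 'a) rel_struct"
  assumes fin: "\<And>F. finite F \<Longrightarrow> F \<subseteq> \<Delta> \<Longrightarrow> \<exists>e. range e \<subseteq> universe M \<and> (\<forall>\<psi>\<in>F. sat M e \<psi>)"
    and complete: "\<And>\<psi>. \<psi> \<in> \<Delta> \<or> Neg \<psi> \<in> \<Delta>"
    and witness: "\<And>\<phi>. Exists \<phi> \<in> \<Delta> \<Longrightarrow> \<exists>j. rename (case_nat j id) \<phi> \<in> \<Delta>"
  obtains N :: "('r, nat) rel_struct" and e where "N \<Turnstile> complete_theory M"
    and "universe N = range e" and "\<And>\<psi>. sat N e \<psi> \<longleftrightarrow> \<psi> \<in> \<Delta>"
proof -
  \<comment> \<open>Otherwise completeness puts \<open>Neg \<psi>\<close> into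
    \<open>\<Delta>\<close>, against finite satisfiability in \<open>M\<close>. So
    \<open>\<Delta>\<close> is closed under consequence over \<open>M\<close>, and the laws below
    reduce to truth in \<open>M\<close>.\<close>
  have closed: "\<psi> \<in> \<Delta>"
    if F: "finite F" "F \<subseteq> \<Delta>"
      "\<And>e. range e \<subseteq> universe M \<Longrightarrow> \<forall>\<phi>\<in>F. sat M e \<phi> \<Longrightarrow> sat M e \<psi>" for F \<psi>
  proof (rule ccontr)
    assume "\<psi> \<notin> \<Delta>"
    then have "insert (Neg \<psi>) F \<subseteq> \<Delta>" using complete F by blast
    then obtain e where "range e \<subseteq> universe M" "\<forall>\<phi>\<in>insert (Neg \<psi>) F. sat M e \<phi>"
      using fin[of "insert (Neg \<psi>) F"] F by auto
    then show False using F(3)[of e] by auto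
  qed
  have closed0: "\<psi> \<in> \<Delta>" if "\<And>e. range e \<subseteq> universe M \<Longrightarrow> sat M e \<psi>" for \<psi>
    using closed[of "{}"] that by auto
  have closed1: "\<psi> \<in> \<Delta>"
    if "\<phi> \<in> \<Delta>" "\<And>e. range e \<subseteq> universe M \<Longrightarrow> sat M e \<phi> \<Longrightarrow> sat M e \<psi>" for \<phi> \<psi>
    using closed[of "{\<phi>}"] that by auto
  have closed2: "\<psi> \<in> \<Delta>"
    if "\<phi>1 \<in> \<Delta>" "\<phi>2 \<in> \<Delta>"
      "\<And>e. range e \<subseteq> universe M \<Longrightarrow> sat M e \<phi>1 \<Longrightarrow> sat M e \<phi>2 \<Longrightarrow> sat M e \<psi>" for \<phi>1 \<phi>2 \<psi>
    using closed[of "{\<phi>1, \<phi>2}"] that by auto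
  have neg: "Neg \<psi> \<in> \<Delta> \<longleftrightarrow> \<psi> \<notin> \<Delta>" for \<psi>
    using complete[of \<psi>] fin[of "{\<psi>, Neg \<psi>}"] by auto
  have conj: "\<phi> \<^bold>\<and> \<psi> \<in> \<Delta> \<longleftrightarrow> \<phi> \<in> \<Delta> \<and> \<psi> \<in> \<Delta>" for \<phi> \<psi>
    by (auto intro: closed1[of "\<phi> \<^bold>\<and> \<psi>"] closed2[of \<phi> \<psi>])
  have ex: "Exists \<phi> \<in> \<Delta> \<longleftrightarrow> (\<exists>j. rename (case_nat j id) \<phi> \<in> \<Delta>)" for \<phi>
  proof
    assume "\<exists>j. rename (case_nat j id) \<phi> \<in> \<Delta>"
    then obtain j where j: "rename (case_nat j id) \<phi> \<in> \<Delta>" by blast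
    show "Exists \<phi> \<in> \<Delta>"
    proof (rule closed1[OF j])
      fix e assume e: "range e \<subseteq> universe M" "sat M e (rename (case_nat j id) \<phi>)"
      have "(\<lambda>n. e (case_nat j id n)) = case_nat (e j) e" by (auto split: nat.split)
      with e have "sat M (case_nat (e j) e) \<phi>" by simp
      with e show "sat M e (Exists \<phi>)" by auto
    qed
  qed (rule witness)

  have eq_refl: "(i \<^bold>= i) \<in> \<Delta>" for i by (rule closed0) simp
  have eq_sym: "(i \<^bold>= j) \<in> \<Delta> \<Longrightarrow> (j \<^bold>= i) \<in> \<Delta>" for i j by (erule closed1) simp
  have eq_trans: "(i \<^bold>= j) \<in> \<Delta> \<Longrightarrow> (j \<^bold>= k) \<in> \<Delta> \<Longrightarrow> (i \<^bold>= k) \<in> \<Delta>" for i j k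
    by (rule closed2[of "i \<^bold>= j" "j \<^bold>= k"]) simp_all
  \<comment> \<open>Variables that \<open>\<Delta>\<close> declares equal must become one element.
    The least variable represents its class, which keeps the universe a set of naturals.\<close>
  define rep where "rep i = (LEAST j. (i \<^bold>= j) \<in> \<Delta>)" for i
  have rep: "(i \<^bold>= rep i) \<in> \<Delta>" for i
    unfolding rep_def by (rule LeastI) (rule eq_refl)
  have rep_eq: "rep i = rep j \<longleftrightarrow> (i \<^bold>= j) \<in> \<Delta>" for i j
  proof
    assume "(i \<^bold>= j) \<in> \<Delta>"
    then have "(\<lambda>k. (i \<^bold>= k) \<in> \<Delta>) = (\<lambda>k. (j \<^bold>= k) \<in> \<Delta>)" using eq_sym eq_trans by blast
    then show "rep i = rep j" by (simp add: rep_def)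
  qed (metis rep eq_sym eq_trans)
  have rel: "Rel r (rep i) (rep j) \<in> \<Delta> \<longleftrightarrow> Rel r i j \<in> \<Delta>" for r i j
  proof
    assume "Rel r (rep i) (rep j) \<in> \<Delta>"
    then show "Rel r i j \<in> \<Delta>"
      using rep[of i] rep[of j]
      by (intro closed[of "{i \<^bold>= rep i, j \<^bold>= rep j, Rel r (rep i) (rep j)}"]) simp_all
  next
    assume "Rel r i j \<in> \<Delta>"
    then show "Rel r (rep i) (rep j) \<in> \<Delta>"
      using rep[of i] rep[of j]
      by (intro closed[of "{i \<^bold>= rep i, j \<^bold>= rep j, Rel r i j}"], simp_all) metis
  qed
  define N where "N = \<lparr>universe = range rep, interp = (\<lambda>r x y. Rel r x y \<in> \<Delta>)\<rparr>"
  \<comment> \<open>Generalised over renamings: below a quantifier the assignment gains a new first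
    value \<open>rep j\<close>, and the result is again \<open>rep\<close> after a renaming.\<close>
  have truth_rename: "sat N (\<lambda>n. rep (f n)) \<psi> \<longleftrightarrow> rename f \<psi> \<in> \<Delta>" for f \<psi>
  proof (induction \<psi> arbitrary: f)
    case (Exists \<phi>)
    have "(\<lambda>n. rep (case_nat j f n)) = case_nat (rep j) (\<lambda>n. rep (f n))" for j
      by (auto split: nat.split)
    then have "sat N (\<lambda>n. rep (f n)) (Exists \<phi>) \<longleftrightarrow> (\<exists>j. rename (case_nat j f) \<phi> \<in> \<Delta>)"
      using Exists.IH[of "case_nat _ f"] by (simp add: N_def)
    \<comment> \<open>The two formulas are only compared semantically; this suffices because
      \<open>\<Delta>\<close> is closed under equivalence over \<open>M\<close>.\<close>
    moreover have "rename (case_nat j f) \<phi> \<in> \<Delta> \<longleftrightarrow>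
      rename (case_nat j id) (rename (case_nat 0 (\<lambda>n. Suc (f n))) \<phi>) \<in> \<Delta>" for j
    proof -
      have "(\<lambda>n. e (case_nat j id (case_nat 0 (\<lambda>n. Suc (f n)) n))) = (\<lambda>n. e (case_nat j f n))"
        for e :: "nat \<Rightarrow> 'a"
        by (auto split: nat.split)
      then show ?thesis by (auto elim!: closed1)
    qed
    ultimately show ?case by (simp add: ex)
  qed (auto simp: N_def rep_eq rel neg conj)
  have truth: "sat N rep \<psi> \<longleftrightarrow> \<psi> \<in> \<Delta>" for \<psi>
  proof -
    have "rename (\<lambda>n. n) \<psi> \<in> \<Delta> \<longleftrightarrow> \<psi> \<in> \<Delta>"
      using closed1[of "rename (\<lambda>n. n) \<psi>" \<psi>] closed1[of \<psi> "rename (\<lambda>n. n) \<psi>"]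
      unfolding sat_rename by blast
    then show ?thesis using truth_rename[of "\<lambda>n. n" \<psi>] by simp
  qed
  have "valid N \<phi>" if \<phi>: "\<phi> \<in> complete_theory M" for \<phi>
  proof -
    have "\<phi> \<in> \<Delta>" using \<phi> by (intro closed0) (auto simp: complete_theory_def valid_def)
    then have "sat N rep \<phi>" by (simp add: truth)
    moreover have "sat N e \<phi> \<longleftrightarrow> sat N rep \<phi>" for e
      using \<phi> by (intro sat_fv_cong) (auto simp: complete_theory_def sentence_def)
    ultimately show ?thesis by (simp add: valid_def)
  qed
  then have "N \<Turnstile> complete_theory M" by (simp add: models_def N_def)
  moreover have "universe N = range rep" by (simp add: N_def)
  ultimately show ?thesis using truth by (rule that)
qed

text \<open>\<open>rename (case_nat j id) \<phi>\<close> instantiates the bound variable with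
  variable \<open>j\<close>. A \<open>j\<close> foreign to both formulas can be reassigned to a
  witness without disturbing \<open>\<theta>\<close>. It is also kept different from 0, since
  variable 0 will name the point realising the limit type.\<close>

lemma fresh_witness:
  obtains j where "\<And>e. range e \<subseteq> universe M \<Longrightarrow> sat M e (\<theta> \<^bold>\<and> Exists \<phi>) \<Longrightarrow>
    \<exists>e'. range e' \<subseteq> universe M \<and> e' 0 = e 0 \<and> sat M e' (\<theta> \<^bold>\<and> rename (case_nat j id) \<phi>)"
proof -
  have "finite (insert 0 (fv (\<theta> \<^bold>\<and> Exists \<phi>)))" by (simp only: finite_insert finite_fv)
  then obtain j where "j \<notin> insert 0 (fv (\<theta> \<^bold>\<and> Exists \<phi>))"
    using ex_new_if_finite[OF infinite_UNIV_nat] by metis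
  then have j: "j \<noteq> 0" "j \<notin> fv \<theta>" "Suc j \<notin> fv \<phi>" by simp_all
  have "\<exists>e'. range e' \<subseteq> universe M \<and> e' 0 = e 0 \<and> sat M e' (\<theta> \<^bold>\<and> rename (case_nat j id) \<phi>)"
    if e: "range e \<subseteq> universe M" "sat M e (\<theta> \<^bold>\<and> Exists \<phi>)" for e
  proof -
    from e(2) obtain b where b: "b \<in> universe M" "sat M (case_nat b e) \<phi>" by auto
    let ?e = "e(j := b)"
    have "sat M ?e \<theta> \<longleftrightarrow> sat M e \<theta>" using j by (intro sat_fv_cong) auto
    moreover have "sat M (\<lambda>n. ?e (case_nat j id n)) \<phi> \<longleftrightarrow> sat M (case_nat b e) \<phi>"
    proof (rule sat_fv_cong)
      show "?e (case_nat j id n) = case_nat b e n" if "n \<in> fv \<phi>" for n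
        using that j(3) by (cases n) auto
    qed
    ultimately have "sat M ?e (\<theta> \<^bold>\<and> rename (case_nat j id) \<phi>)"
      using e(2) b(2) by (simp del: fun_upd_apply)
    moreover have "range ?e \<subseteq> universe M" using e(1) b(1) by auto
    moreover have "?e 0 = e 0" using j(1) by simp
    ultimately show ?thesis by blast
  qed
  then show ?thesis by (rule that)
qed

text \<open>Common to the realising and the omitting model: \<open>P\<close> says which conditions
  are allowed, \<open>\<R>\<close> holds the requirements peculiar to the model. By the last
  conclusion every truth of \<open>N\<close> follows from an allowed condition, so properties of
  conditions pass to the formulas true in \<open>N\<close>.\<close>

lemma generic_model:
  fixes M :: "('r::countable, 'a) rel_struct"
  assumes P: "P \<theta>0" and R: "countable \<R>"
    and dense: "\<And>\<theta> R. P \<theta> \<Longrightarrow> R \<in> \<R> \<Longrightarrow> \<exists>\<psi>\<in>R. P (\<theta> \<^bold>\<and> \<psi>)"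
    and sat: "\<And>\<theta>. P \<theta> \<Longrightarrow> \<exists>e. range e \<subseteq> universe M \<and> sat M e \<theta>"
    and split: "\<And>\<theta> \<psi>. P \<theta> \<Longrightarrow> P (\<theta> \<^bold>\<and> \<psi>) \<or> P (\<theta> \<^bold>\<and> Neg \<psi>)"
    and witness: "\<And>\<theta> \<phi>. P (\<theta> \<^bold>\<and> Exists \<phi>) \<Longrightarrow> \<exists>j. P (\<theta> \<^bold>\<and> rename (case_nat j id) \<phi>)"
  obtains N :: "('r, nat) rel_struct" and e where "N \<Turnstile> complete_theory M"
    and "universe N = range e"
    and "\<And>R. R \<in> \<R> \<Longrightarrow> \<exists>\<psi>\<in>R. sat N e \<psi>"
    and "\<And>\<psi>. sat N e \<psi> \<Longrightarrow> \<exists>\<theta>. P \<theta> \<and> (\<forall>e. sat M e \<theta> \<longrightarrow> sat M e \<psi>)"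
proof -
  let ?decide = "range (\<lambda>\<psi>. {\<psi>, Neg \<psi>})"
  \<comment> \<open>Offering \<open>Neg (Exists \<phi>)\<close> as an alternative lets the
    requirement be met whichever way \<open>Exists \<phi>\<close> is decided.\<close>
  let ?wit = "range (\<lambda>\<phi>. insert (Neg (Exists \<phi>)) (range (\<lambda>j. rename (case_nat j id) \<phi>)))"
  have "countable (\<R> \<union> ?decide \<union> ?wit)" using R by simp
  moreover have "\<exists>\<psi>\<in>R'. P (\<theta> \<^bold>\<and> \<psi>)" if "P \<theta>" "R' \<in> \<R> \<union> ?decide \<union> ?wit" for \<theta> R'
  proof -
    from that(2) consider "R' \<in> \<R>" | \<psi> where "R' = {\<psi>, Neg \<psi>}"
      | \<phi> where "R' = insert (Neg (Exists \<phi>)) (range (\<lambda>j. rename (case_nat j id) \<phi>))"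
      by blast
    then show ?thesis
    proof cases
      case 1
      then show ?thesis by (rule dense[OF that(1)])
    next
      case (2 \<psi>)
      then show ?thesis using split[OF that(1), of \<psi>] by simp
    next
      case (3 \<phi>)
      from split[OF that(1), of "Exists \<phi>"] show ?thesis
      proof
        assume "P (\<theta> \<^bold>\<and> Exists \<phi>)"
        then obtain j where "P (\<theta> \<^bold>\<and> rename (case_nat j id) \<phi>)" using witness by blast
        with 3 show ?thesis by blast
      qed (use 3 in simp)
    qed
  qed
  ultimately obtain \<Delta> where meets: "\<And>R'. R' \<in> \<R> \<union> ?decide \<union> ?wit \<Longrightarrow> R' \<inter> \<Delta> \<noteq> {}"
    and fin: "\<And>F. finite F \<Longrightarrow> F \<subseteq> \<Delta> \<Longrightarrow> \<exists>\<theta>. P \<theta> \<and> (\<forall>e. sat M e \<theta> \<longrightarrow> (\<forall>\<psi>\<in>F. sat M e \<psi>))"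
    by (rule generic_set[where P = P and M = M, OF P]) (assumption | rule that)+
  have fin': "\<exists>e. range e \<subseteq> universe M \<and> (\<forall>\<psi>\<in>F. sat M e \<psi>)"
    if "finite F" "F \<subseteq> \<Delta>" for F
  proof -
    obtain \<theta> where \<theta>: "P \<theta>" "\<forall>e. sat M e \<theta> \<longrightarrow> (\<forall>\<psi>\<in>F. sat M e \<psi>)"
      using fin[OF \<open>finite F\<close> \<open>F \<subseteq> \<Delta>\<close>] by blast
    from sat[OF \<theta>(1)] \<theta>(2) show ?thesis by blast
  qed
  have complete: "\<psi> \<in> \<Delta> \<or> Neg \<psi> \<in> \<Delta>" for \<psi>
  proof -
    have "{\<psi>, Neg \<psi>} \<inter> \<Delta> \<noteq> {}" by (rule meets) blast
    then show ?thesis by blast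
  qed
  have wit: "\<exists>j. rename (case_nat j id) \<phi> \<in> \<Delta>" if "Exists \<phi> \<in> \<Delta>" for \<phi>
  proof -
    have "\<not> {Exists \<phi>, Neg (Exists \<phi>)} \<subseteq> \<Delta>"
      using fin'[of "{Exists \<phi>, Neg (Exists \<phi>)}"] by auto
    moreover have "insert (Neg (Exists \<phi>)) (range (\<lambda>j. rename (case_nat j id) \<phi>)) \<inter> \<Delta> \<noteq> {}"
      by (rule meets) blast
    ultimately show ?thesis using that by blast
  qed
  obtain N :: "('r, nat) rel_struct" and e where N: "N \<Turnstile> complete_theory M" "universe N = range e"
    and truth: "\<And>\<psi>. sat N e \<psi> \<longleftrightarrow> \<psi> \<in> \<Delta>"
    by (rule henkin_model[OF fin' complete wit]) (assumption | rule that)+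
  show ?thesis
  proof (rule that[OF N])
    show "\<exists>\<psi>\<in>R'. sat N e \<psi>" if "R' \<in> \<R>" for R'
      using meets[of R'] that by (auto simp: truth)
    show "\<exists>\<theta>. P \<theta> \<and> (\<forall>e. sat M e \<theta> \<longrightarrow> sat M e \<psi>)" if "sat N e \<psi>" for \<psi>
      using fin[of "{\<psi>}"] that by (simp add: truth)
  qed
qed

section \<open>Infinitely many types contradict categoricity\<close>

definition Exs :: "nat \<Rightarrow> 'r fm \<Rightarrow> 'r fm"
  where "Exs n = Exists ^^ n"

text \<open>The \<open>n\<close> binders capture the indices below \<open>n\<close> and shift the
  outer variables up by \<open>n\<close>, hence \<open>e (i - n)\<close>.\<close>

lemma sat_Exs:
  "sat M e (Exs n \<phi>) \<longleftrightarrow>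
    (\<exists>f. (\<forall>i<n. f i \<in> universe M) \<and> sat M (\<lambda>i. if i < n then f i else e (i - n)) \<phi>)"
proof (induction n arbitrary: \<phi>)
  case 0
  then show ?case by (simp add: Exs_def)
next
  case (Suc n)
  \<comment> \<open>The innermost quantifier is split off, so that the induction hypothesis, general
    in \<open>\<phi>\<close>, applies with the same \<open>e\<close>.\<close>
  have "Exs (Suc n) \<phi> = Exs n (Exists \<phi>)" by (simp add: Exs_def funpow_swap1)
  then have *: "sat M e (Exs (Suc n) \<phi>) \<longleftrightarrow> (\<exists>f. (\<forall>i<n. f i \<in> universe M) \<and>
      (\<exists>a\<in>universe M. sat M (case_nat a (\<lambda>i. if i < n then f i else e (i - n))) \<phi>))"
    by (simp add: Suc.IH)
  have shift: "case_nat a (\<lambda>i. if i < n then f i else e (i - n)) =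
      (\<lambda>i. if i < Suc n then case_nat a f i else e (i - Suc n))" for a f
    by (auto split: nat.split)
  show ?case
  proof
    assume "sat M e (Exs (Suc n) \<phi>)"
    then obtain f a where "\<forall>i<n. f i \<in> universe M" "a \<in> universe M"
      "sat M (\<lambda>i. if i < Suc n then case_nat a f i else e (i - Suc n)) \<phi>"
      unfolding * shift by blast
    then show "\<exists>f. (\<forall>i<Suc n. f i \<in> universe M) \<and>
        sat M (\<lambda>i. if i < Suc n then f i else e (i - Suc n)) \<phi>"
      by (intro exI[of _ "case_nat a f"]) (auto split: nat.split)
  next
    assume "\<exists>f. (\<forall>i<Suc n. f i \<in> universe M) \<and>
        sat M (\<lambda>i. if i < Suc n then f i else e (i - Suc n)) \<phi>"
    then obtain f where f: "\<forall>i<Suc n. f i \<in> universe M"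
      "sat M (\<lambda>i. if i < Suc n then f i else e (i - Suc n)) \<phi>" by blast
    have "case_nat (f 0) (\<lambda>i. f (Suc i)) = f" by (auto simp: fun_eq_iff split: nat.split)
    then have "sat M (\<lambda>i. if i < Suc n then case_nat (f 0) (\<lambda>i. f (Suc i)) i else e (i - Suc n)) \<phi>"
      by (simp only: f(2))
    with f(1) show "sat M e (Exs (Suc n) \<phi>)"
      unfolding * shift by (intro exI[of _ "\<lambda>i. f (Suc i)"] conjI bexI[of _ "f 0"]) auto
  qed
qed

lemma fv_Exs: "fv (Exs n \<phi>) = {i. i + n \<in> fv \<phi>}"
  by (induction n arbitrary: \<phi>) (auto simp: Exs_def)

lemma fv_rename: "fv (rename f \<phi>) \<subseteq> f ` fv \<phi>"
proof (induction \<phi> arbitrary: f)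
  case (Exists \<phi>)
  show ?case
  proof
    fix n assume "n \<in> fv (rename f (Exists \<phi>))"
    then obtain m where "m \<in> fv \<phi>" "Suc n = case_nat 0 (\<lambda>n. Suc (f n)) m"
      using Exists.IH by fastforce
    then show "n \<in> f ` fv (Exists \<phi>)" by (auto split: nat.splits)
  qed
qed (simp; blast)+

text \<open>All variables but \<open>k\<close> are quantified away. The bound \<open>m\<close> lies
  above \<open>k\<close> and every free variable, so once \<open>k\<close> is moved to
  \<open>m\<close> it alone escapes the \<open>m\<close> quantifiers, and it comes out as variable
  0. The formula \<open>\<chi>\<close> expresses what \<open>\<theta>\<close> imposes on the element
  named by \<open>k\<close>.\<close>

lemma projection_definable:
  obtains \<chi> where "fv \<chi> \<subseteq> {0}"
    and "\<And>e'. e' 0 \<in> universe M \<Longrightarrow>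
      sat M e' \<chi> \<longleftrightarrow> (\<exists>e. range e \<subseteq> universe M \<and> e k = e' 0 \<and> sat M e \<theta>)"
proof -
  have "finite (insert k (fv \<theta>))" by simp
  then obtain m where m: "\<forall>i\<in>insert k (fv \<theta>). i < m"
    unfolding finite_nat_set_iff_bounded by blast
  let ?f = "\<lambda>i. if i = k then m else i"
  let ?\<chi> = "Exs m (rename ?f \<theta>)"
  show ?thesis
  proof (rule that)
    show "fv ?\<chi> \<subseteq> {0}"
      using fv_rename[of ?f \<theta>] m by (fastforce simp: fv_Exs split: if_splits)
  next
    fix e' :: "nat \<Rightarrow> 'b" assume e': "e' 0 \<in> universe M"
    have *: "sat M (\<lambda>i. if ?f i < m then g (?f i) else e' (?f i - m)) \<theta> \<longleftrightarrow> sat M e \<theta>"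
      if "e k = e' 0" "\<And>i. i \<in> fv \<theta> \<Longrightarrow> i \<noteq> k \<Longrightarrow> g i = e i" for g e
      using that m by (intro sat_fv_cong) auto
    show "sat M e' ?\<chi> \<longleftrightarrow> (\<exists>e. range e \<subseteq> universe M \<and> e k = e' 0 \<and> sat M e \<theta>)"
    proof
      assume "sat M e' ?\<chi>"
      then obtain g where g: "\<forall>i<m. g i \<in> universe M"
        "sat M (\<lambda>i. if ?f i < m then g (?f i) else e' (?f i - m)) \<theta>"
        unfolding sat_Exs sat_rename by blast
      \<comment> \<open>The value \<open>e' 0\<close> is the prescribed one at \<open>k\<close>;
        from \<open>m\<close> on it is a filler inside the universe, beyond the free variables of
        \<open>\<theta>\<close>.\<close>
      let ?e = "\<lambda>i. if i < m \<and> i \<noteq> k then g i else e' 0"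
      have "sat M ?e \<theta>" using g(2) *[of ?e g] m by auto
      then show "\<exists>e. range e \<subseteq> universe M \<and> e k = e' 0 \<and> sat M e \<theta>"
        using g(1) e' by (intro exI[of _ ?e]) auto
    next
      assume "\<exists>e. range e \<subseteq> universe M \<and> e k = e' 0 \<and> sat M e \<theta>"
      then obtain e where "range e \<subseteq> universe M" "e k = e' 0" "sat M e \<theta>" by blast
      then show "sat M e' ?\<chi>"
        unfolding sat_Exs sat_rename using *[of e e] by (intro exI[of _ e]) auto
    qed
  qed
qed

text \<open>A generic limit of the types of the \<open>a n\<close> is a type that no formula isolates: an isolating
  formula would hold at infinitely many of the \<open>a n\<close>, which would then all have the limit type.
  So the limit type is realised in one countable model and omitted in another.\<close>

theorem not_aleph0_categorical:
  fixes M :: "('r::countable, 'a) rel_struct"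
  assumes a: "\<And>n :: nat. a n \<in> universe M"
    and fv: "\<And>n. fv (\<gamma> n) \<subseteq> {0}"
    and sat: "\<And>n. sat M (\<lambda>_. a n) (\<gamma> n)"
    and fin: "\<And>n. finite {m. sat M (\<lambda>_. a m) (\<gamma> n)}"
  shows "\<not> aleph0_categorical M"
proof
  assume cat: "aleph0_categorical M"
  \<comment> \<open>Variable 0 names the point under construction; the others stay existential, free
    to serve as Henkin constants. The allowed conditions will be those with
    \<open>A \<theta>\<close> infinite.\<close>
  define A where "A \<theta> = {n. \<exists>e. range e \<subseteq> universe M \<and> e 0 = a n \<and> sat M e \<theta>}" for \<theta>
  have A1: "A \<psi> = {n. sat M (\<lambda>_. a n) \<psi>}" if "fv \<psi> \<subseteq> {0}" for \<psi>
  proof -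
    have "sat M e \<psi> \<longleftrightarrow> sat M (\<lambda>_. a n) \<psi>" if "e 0 = a n" for e n
      using \<open>fv \<psi> \<subseteq> {0}\<close> that by (intro sat_fv_cong) auto
    note * = this
    have "(\<exists>e. range e \<subseteq> universe M \<and> e 0 = a n \<and> sat M e \<psi>) \<longleftrightarrow> sat M (\<lambda>_. a n) \<psi>" for n
    proof
      assume "sat M (\<lambda>_. a n) \<psi>"
      then show "\<exists>e. range e \<subseteq> universe M \<and> e 0 = a n \<and> sat M e \<psi>"
        using a by (intro exI[of _ "\<lambda>_. a n"]) auto
    qed (use * in blast)
    then show ?thesis by (simp add: A_def)
  qed
  have split: "infinite (A (\<theta> \<^bold>\<and> \<psi>)) \<or> infinite (A (\<theta> \<^bold>\<and> Neg \<psi>))" if "infinite (A \<theta>)" for \<theta> \<psi>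
  proof -
    have "A \<theta> = A (\<theta> \<^bold>\<and> \<psi>) \<union> A (\<theta> \<^bold>\<and> Neg \<psi>)" by (auto simp: A_def)
    with that show ?thesis by auto
  qed
  \<comment> \<open>\<open>\<gamma> n\<close> holds at only finitely many of the points, so every
    allowed condition can be extended by its negation.\<close>
  have Neg_\<gamma>: "infinite (A (\<theta> \<^bold>\<and> Neg (\<gamma> n)))" if "infinite (A \<theta>)" for \<theta> n
  proof -
    have "A (\<theta> \<^bold>\<and> \<gamma> n) \<subseteq> A (\<gamma> n)" by (auto simp: A_def)
    then have "finite (A (\<theta> \<^bold>\<and> \<gamma> n))" using fin[of n] A1[OF fv] by (simp add: finite_subset)
    with split[OF that, of "\<gamma> n"] show ?thesis by blast
  qed
  have wit: "\<exists>j. infinite (A (\<theta> \<^bold>\<and> rename (case_nat j id) \<phi>))"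
    if "infinite (A (\<theta> \<^bold>\<and> Exists \<phi>))" for \<theta> \<phi>
  proof -
    obtain j where "\<And>e. range e \<subseteq> universe M \<Longrightarrow> sat M e (\<theta> \<^bold>\<and> Exists \<phi>) \<Longrightarrow>
      \<exists>e'. range e' \<subseteq> universe M \<and> e' 0 = e 0 \<and> sat M e' (\<theta> \<^bold>\<and> rename (case_nat j id) \<phi>)"
      using fresh_witness by blast
    then have "A (\<theta> \<^bold>\<and> Exists \<phi>) \<subseteq> A (\<theta> \<^bold>\<and> rename (case_nat j id) \<phi>)"
      unfolding A_def by (smt (verit) Collect_mono_iff)
    then show ?thesis using that finite_subset by blast
  qed
  have "A (0 \<^bold>= 0) = UNIV" using A1[of "0 \<^bold>= 0"] by simp
  then have start: "infinite (A (0 \<^bold>= 0))" by simp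
  obtain N :: "('r, nat) rel_struct" and e where N: "N \<Turnstile> complete_theory M" "universe N = range e"
    and NR: "\<And>R. R \<in> range (\<lambda>n. {Neg (\<gamma> n)}) \<Longrightarrow> \<exists>\<psi>\<in>R. sat N e \<psi>"
    and NA: "\<And>\<psi>. sat N e \<psi> \<Longrightarrow> \<exists>\<theta>. infinite (A \<theta>) \<and> (\<forall>e. sat M e \<theta> \<longrightarrow> sat M e \<psi>)"
  proof (rule generic_model[where P = "\<lambda>\<theta>. infinite (A \<theta>)" and \<R> = "range (\<lambda>n. {Neg (\<gamma> n)})"
        and M = M, OF start])
    show "\<exists>e. range e \<subseteq> universe M \<and> sat M e \<theta>" if "infinite (A \<theta>)" for \<theta>
    proof -
      have "A \<theta> \<noteq> {}" using that by auto
      then show ?thesis by (auto simp: A_def)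
    qed
    show "\<exists>\<psi>\<in>R. infinite (A (\<theta> \<^bold>\<and> \<psi>))"
      if "infinite (A \<theta>)" "R \<in> range (\<lambda>n. {Neg (\<gamma> n)})" for \<theta> R
      using that Neg_\<gamma> by auto
    show "countable (range (\<lambda>n. {Neg (\<gamma> n)}))" by simp
  next
    show "infinite (A (\<theta> \<^bold>\<and> \<psi>)) \<or> infinite (A (\<theta> \<^bold>\<and> Neg \<psi>))" if "infinite (A \<theta>)" for \<theta> \<psi>
      using that by (rule split)
    show "\<exists>j. infinite (A (\<theta> \<^bold>\<and> rename (case_nat j id) \<phi>))"
      if "infinite (A (\<theta> \<^bold>\<and> Exists \<phi>))" for \<theta> \<phi>
      using that by (rule wit)
  qed (rule that)
  have N\<gamma>: "sat N e (Neg (\<gamma> n))" for n using NR[of "{Neg (\<gamma> n)}"] by auto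
  have NA': "infinite (A \<psi>)" if "sat N e \<psi>" for \<psi>
  proof -
    obtain \<theta> where "infinite (A \<theta>)" "\<forall>e. sat M e \<theta> \<longrightarrow> sat M e \<psi>" using NA[OF \<open>sat N e \<psi>\<close>] by blast
    moreover from this have "A \<theta> \<subseteq> A \<psi>" by (auto simp: A_def)
    ultimately show ?thesis using finite_subset by blast
  qed
  \<comment> \<open>The complete type of \<open>e 0\<close>. By \<open>N\<gamma>\<close> it contains
    every \<open>Neg (\<gamma> n)\<close>, and by \<open>NA'\<close> each of its formulas holds at
    infinitely many \<open>a n\<close>.\<close>
  define p where "p = {\<psi>. fv \<psi> \<subseteq> {0} \<and> sat N e \<psi>}"

  \<comment> \<open>Categoricity makes every model built on the naturals a copy of \<open>M\<close>.
    Applied to \<open>N\<close> it realises \<open>p\<close> in \<open>M\<close>; applied to the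
    second model it will carry this realisation back.\<close>
  have transfer: "\<exists>f. f ` universe K = universe M \<and>
      (\<forall>\<psi> e'. range e' \<subseteq> universe K \<longrightarrow> (sat K e' \<psi> \<longleftrightarrow> sat M (\<lambda>n. f (e' n)) \<psi>))"
    if K: "K \<Turnstile> complete_theory M" for K :: "('r, nat) rel_struct"
  proof -
    have "isomorphic K M" using cat K by (simp add: aleph0_categorical_def)
    then obtain f where f: "bij_betw f (universe K) (universe M)"
      and r: "\<And>r x y. x \<in> universe K \<Longrightarrow> y \<in> universe K \<Longrightarrow>
        interp K r x y \<longleftrightarrow> interp M r (f x) (f y)"
      unfolding isomorphic_def by blast
    from sat_iso[OF f r] f show ?thesis by (intro exI[of _ f]) (auto simp: bij_betw_def)
  qed

  have "\<exists>b\<in>universe M. \<forall>\<psi>\<in>p. sat M (\<lambda>_. b) \<psi>"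
  proof -
    obtain f where f: "f ` universe N = universe M"
      "\<And>\<psi> e'. range e' \<subseteq> universe N \<Longrightarrow> sat N e' \<psi> \<longleftrightarrow> sat M (\<lambda>n. f (e' n)) \<psi>"
      using transfer[OF N(1)] by blast
    have "sat M (\<lambda>_. f (e 0)) \<psi>" if "\<psi> \<in> p" for \<psi>
    proof -
      have "sat M (\<lambda>n. f (e n)) \<psi>" using that f(2)[of e \<psi>] N(2) by (simp add: p_def)
      moreover have "sat M (\<lambda>n. f (e n)) \<psi> \<longleftrightarrow> sat M (\<lambda>_. f (e 0)) \<psi>"
        using that by (intro sat_fv_cong) (auto simp: p_def)
      ultimately show ?thesis by simp
    qed
    moreover have "f (e 0) \<in> universe M" using f(1) N(2) by auto
    ultimately show ?thesis by blast
  qed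
  then obtain b where b: "b \<in> universe M" "\<And>\<psi>. \<psi> \<in> p \<Longrightarrow> sat M (\<lambda>_. b) \<psi>" by blast

  define Q where "Q \<theta> \<longleftrightarrow> (\<exists>e. range e \<subseteq> universe M \<and> sat M e \<theta>)" for \<theta>
  \<comment> \<open>Meeting \<open>R k\<close> makes the element named by \<open>k\<close> violate
    some formula of \<open>p\<close>; the renaming moves the only free variable, 0, to
    \<open>k\<close>.\<close>
  define R where "R k = {Neg (rename (\<lambda>_. k) \<psi>) |\<psi>. \<psi> \<in> p}" for k :: nat
  have omit: "\<exists>\<psi>\<in>R k. Q (\<theta> \<^bold>\<and> \<psi>)" if "Q \<theta>" for \<theta> k
  proof (rule ccontr)
    assume "\<not> ?thesis"
    then have p: "sat M (\<lambda>_. e' k) \<psi>"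
      if "\<psi> \<in> p" "range e' \<subseteq> universe M" "sat M e' \<theta>" for e' \<psi>
      using that by (auto simp: R_def Q_def)
    \<comment> \<open>\<open>\<chi>\<close> defines the values at \<open>k\<close> compatible with
      \<open>\<theta>\<close>, all of which realise \<open>p\<close>. If
      \<open>\<chi> \<in> p\<close>, some \<open>a n\<close> is such a value although
      \<open>Neg (\<gamma> n)\<close> is in \<open>p\<close>. Otherwise \<open>Neg \<chi>\<close> is
      in \<open>p\<close>, although \<open>\<theta>\<close> is satisfiable.\<close>
    obtain \<chi> where \<chi>: "fv \<chi> \<subseteq> {0}" "\<And>e'. e' 0 \<in> universe M \<Longrightarrow>
        sat M e' \<chi> \<longleftrightarrow> (\<exists>e. range e \<subseteq> universe M \<and> e k = e' 0 \<and> sat M e \<theta>)"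
      using projection_definable by blast
    show False
    proof (cases "\<chi> \<in> p")
      case True
      then have "A \<chi> \<noteq> {}" using NA'[of \<chi>] by (auto simp: p_def)
      then obtain n where "sat M (\<lambda>_. a n) \<chi>" using A1[OF \<chi>(1)] by auto
      then obtain e' where e': "range e' \<subseteq> universe M" "e' k = a n" "sat M e' \<theta>"
        using \<chi>(2)[of "\<lambda>_. a n"] a by auto
      have "Neg (\<gamma> n) \<in> p" using fv N\<gamma> by (simp add: p_def)
      from p[OF this e'(1,3)] e'(2) sat show False by simp
    next
      case False
      then have "Neg \<chi> \<in> p" using \<chi>(1) by (simp add: p_def)
      moreover obtain e' where e': "range e' \<subseteq> universe M" "sat M e' \<theta>"
        using \<open>Q \<theta>\<close> by (auto simp: Q_def)
      ultimately have "\<not> sat M (\<lambda>_. e' k) \<chi>" using p by fastforce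
      then show False using \<chi>(2)[of "\<lambda>_. e' k"] e' by auto
    qed
  qed
  obtain N' :: "('r, nat) rel_struct" and e' where N': "N' \<Turnstile> complete_theory M"
    "universe N' = range e'" and N'R: "\<And>k. \<exists>\<psi>\<in>R k. sat N' e' \<psi>"
  proof (rule generic_model[where P = Q and \<R> = "range R" and M = M])
    show "Q (0 \<^bold>= 0)" using a by (auto simp: Q_def intro!: exI[of _ "\<lambda>_. a 0"])
    show "Q (\<theta> \<^bold>\<and> \<psi>) \<or> Q (\<theta> \<^bold>\<and> Neg \<psi>)" if "Q \<theta>" for \<theta> \<psi>
      using that by (auto simp: Q_def)
    show "\<exists>j. Q (\<theta> \<^bold>\<and> rename (case_nat j id) \<phi>)" if "Q (\<theta> \<^bold>\<and> Exists \<phi>)" for \<theta> \<phi>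
      using that fresh_witness[of M \<theta> \<phi>] unfolding Q_def by metis
    show "\<exists>e. range e \<subseteq> universe M \<and> sat M e \<theta>" if "Q \<theta>" for \<theta>
      using that by (simp add: Q_def)
  qed (use omit that in auto)
  obtain f where f: "f ` universe N' = universe M"
    "\<And>\<psi> e'. range e' \<subseteq> universe N' \<Longrightarrow> sat N' e' \<psi> \<longleftrightarrow> sat M (\<lambda>n. f (e' n)) \<psi>"
    using transfer[OF N'(1)] by blast
  \<comment> \<open>Every element of \<open>N'\<close> is named by a variable, and so is the
    preimage of \<open>b\<close>.\<close>
  obtain k where k: "f (e' k) = b" using f(1) N'(2) b(1) by (metis imageE)
  obtain \<psi> where "\<psi> \<in> p" "\<not> sat N' (\<lambda>_. e' k) \<psi>" using N'R[of k] by (auto simp: R_def)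
  then show False using f(2)[of "\<lambda>_. e' k" \<psi>] N'(2) k b(2)[of \<psi>] by auto
qed

section \<open>Finite flat systems in models of ZFA\<close>

locale ZFA_model =
  fixes M :: "(set_sym, 'a) rel_struct"
  assumes ZFA: "M \<Turnstile> ZFA"
begin

abbreviation U :: "'a set" where "U \<equiv> universe M"

lemma sat_ZFA: "\<phi> \<in> ZFA \<Longrightarrow> \<exists>e. sat M e \<phi>"
proof -
  assume "\<phi> \<in> ZFA"
  obtain a where "a \<in> U" using ZFA by (auto simp: models_def)
  then have "sat M (\<lambda>_. a) \<phi>" using ZFA \<open>\<phi> \<in> ZFA\<close> by (auto simp: models_def valid_def)
  then show ?thesis by blast
qed

lemma extensionality: "x \<in> U \<Longrightarrow> y \<in> U \<Longrightarrow> (\<And>z. z \<in> U \<Longrightarrow> mem M z x \<longleftrightarrow> mem M z y) \<Longrightarrow> x = y"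
  using sat_ZFA[of Extensionality_ax] by (simp add: ZFA_def sat_Extensionality_ax)

lemma pairing: "x \<in> U \<Longrightarrow> y \<in> U \<Longrightarrow> \<exists>z\<in>U. \<forall>w\<in>U. mem M w z \<longleftrightarrow> w = x \<or> w = y"
  using sat_ZFA[of Pairing_ax] by (simp add: ZFA_def sat_Pairing_ax is_upair_def)

lemma union:
  "a \<in> U \<Longrightarrow> \<exists>u\<in>U. \<forall>x\<in>U. mem M x u \<longleftrightarrow> (\<exists>y\<in>U. mem M x y \<and> mem M y a)"
  using sat_ZFA[of Union_ax] by (simp add: ZFA_def sat_Union_ax)

lemma empty_set_exists: "\<exists>z\<in>U. \<forall>w\<in>U. \<not> mem M w z"
proof -
  have "\<exists>e. sat M e Infinity_ax" by (rule sat_ZFA) (simp add: ZFA_def)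
  then show ?thesis unfolding sat_Infinity_ax by blast
qed

lemma AFA:
  "X \<in> U \<Longrightarrow> A \<in> U \<Longrightarrow> S \<in> U \<Longrightarrow> is_flat_system M X A S \<Longrightarrow> \<exists>s\<in>U. is_solution M s X A S"
  using sat_ZFA[of AFA_ax] by (simp add: ZFA_def sat_AFA_ax) blast

text \<open>Finiteness is external, so the induction takes place outside the model; its step forms
  the union of the pair of \<open>z\<close> and the singleton of \<open>x\<close>.\<close>

lemma finite_set_exists:
  "finite F \<Longrightarrow> F \<subseteq> U \<Longrightarrow> \<exists>z\<in>U. \<forall>w\<in>U. mem M w z \<longleftrightarrow> w \<in> F"
proof (induction rule: finite_induct)
  case empty
  then show ?case using empty_set_exists by simp
next
  case (insert x F)
  then obtain z where z: "z \<in> U" "\<forall>w\<in>U. mem M w z \<longleftrightarrow> w \<in> F" by auto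
  from insert.prems obtain s where s: "s \<in> U" "\<forall>w\<in>U. mem M w s \<longleftrightarrow> w = x"
    using pairing[of x x] by auto
  obtain q where q: "q \<in> U" "\<forall>w\<in>U. mem M w q \<longleftrightarrow> w = z \<or> w = s"
    using pairing[OF z(1) s(1)] by auto
  obtain u where "u \<in> U" "\<forall>w\<in>U. mem M w u \<longleftrightarrow> (\<exists>y\<in>U. mem M w y \<and> mem M y q)"
    using union[OF q(1)] by auto
  then show ?case using z s q by (intro bexI[of _ u]) auto
qed

text \<open>Code in the model of an external finite set; the choice is justified only for
  \<open>F\<close> finite and inside \<open>U\<close>.\<close>

definition fset :: "'a set \<Rightarrow> 'a"
  where "fset F = (SOME z. z \<in> U \<and> (\<forall>w\<in>U. mem M w z \<longleftrightarrow> w \<in> F))"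

lemma
  assumes "finite F" "F \<subseteq> U"
  shows fset_in [simp, intro]: "fset F \<in> U"
    and mem_fset [simp]: "w \<in> U \<Longrightarrow> mem M w (fset F) \<longleftrightarrow> w \<in> F"
proof -
  have "fset F \<in> U \<and> (\<forall>w\<in>U. mem M w (fset F) \<longleftrightarrow> w \<in> F)"
    unfolding fset_def by (rule someI_ex) (use finite_set_exists[OF assms] in blast)
  then show "fset F \<in> U" "w \<in> U \<Longrightarrow> mem M w (fset F) \<longleftrightarrow> w \<in> F" by auto
qed

lemma fset_unique:
  "finite F \<Longrightarrow> F \<subseteq> U \<Longrightarrow> z \<in> U \<Longrightarrow> z = fset F \<longleftrightarrow> (\<forall>w\<in>U. mem M w z \<longleftrightarrow> w \<in> F)"
  using extensionality[of z "fset F"] by auto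

lemma fset_eq_iff [simp]:
  "finite F \<Longrightarrow> F \<subseteq> U \<Longrightarrow> finite G \<Longrightarrow> G \<subseteq> U \<Longrightarrow> fset F = fset G \<longleftrightarrow> F = G"
  by (metis fset_in mem_fset subset_antisym subset_iff)

section \<open>Kuratowski pairs and finite functions inside the model\<close>

definition pair :: "'a \<Rightarrow> 'a \<Rightarrow> 'a"
  where "pair x y = fset {fset {x}, fset {x, y}}"

lemma pair_in [simp, intro]: "x \<in> U \<Longrightarrow> y \<in> U \<Longrightarrow> pair x y \<in> U"
  by (simp add: pair_def)

lemma pair_eq_iff [simp]:
  "x \<in> U \<Longrightarrow> y \<in> U \<Longrightarrow> x' \<in> U \<Longrightarrow> y' \<in> U \<Longrightarrow> pair x y = pair x' y' \<longleftrightarrow> x = x' \<and> y = y'"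
  by (auto simp: pair_def doubleton_eq_iff)

lemma is_upair_iff: "x \<in> U \<Longrightarrow> y \<in> U \<Longrightarrow> z \<in> U \<Longrightarrow> is_upair M x y z \<longleftrightarrow> z = fset {x, y}"
  by (simp add: is_upair_def fset_unique)

lemma is_pair_iff: "x \<in> U \<Longrightarrow> y \<in> U \<Longrightarrow> p \<in> U \<Longrightarrow> is_pair M x y p \<longleftrightarrow> p = pair x y"
  by (auto simp: is_pair_def is_upair_iff pair_def)

lemma is_app_fset:
  assumes "finite X" "X \<subseteq> U" "f ` X \<subseteq> U" "x \<in> U" "y \<in> U"
  shows "is_app M (fset ((\<lambda>x. pair x (f x)) ` X)) x y \<longleftrightarrow> x \<in> X \<and> y = f x"
proof -
  have sub: "(\<lambda>x. pair x (f x)) ` X \<subseteq> U" using assms by auto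
  show ?thesis
    using assms sub by (auto simp: is_app_def is_pair_iff image_subset_iff subset_iff)
qed

lemma is_fun_fset:
  assumes "finite X" "X \<subseteq> U" "f ` X \<subseteq> U"
  shows "is_fun M (fset ((\<lambda>x. pair x (f x)) ` X)) (fset X)"
proof -
  have sub: "(\<lambda>x. pair x (f x)) ` X \<subseteq> U" using assms by auto
  show ?thesis
    unfolding is_fun_def
  proof (intro conjI ballI impI)
    fix p assume p: "p \<in> U" "mem M p (fset ((\<lambda>x. pair x (f x)) ` X))"
    then obtain x where "x \<in> X" "p = pair x (f x)" using assms(1) sub by auto
    moreover from this have "x \<in> U" "f x \<in> U" using assms(2,3) by auto
    ultimately have "mem M x (fset X) \<and> is_pair M x (f x) p"
      using assms(1,2) p(1) by (simp add: is_pair_iff)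
    then show "\<exists>x\<in>U. \<exists>y\<in>U. mem M x (fset X) \<and> is_pair M x y p"
      using \<open>x \<in> U\<close> \<open>f x \<in> U\<close> by blast
  next
    fix x assume "x \<in> U" "mem M x (fset X)"
    then show "\<exists>!y. y \<in> U \<and> is_app M (fset ((\<lambda>x. pair x (f x)) ` X)) x y"
      using assms is_app_fset[OF assms] by (intro ex1I[of _ "f x"]) auto
  qed
qed

text \<open>Otherwise every subset of \<open>U\<close> would have a code, and \<open>fset\<close>
  would inject the power set of \<open>U\<close> into \<open>U\<close>.\<close>

lemma infinite_universe: "infinite U"
proof
  assume fin: "finite U"
  have "inj_on fset (Pow U)"
    using fin by (auto simp: inj_on_def finite_subset)
  moreover have "fset ` Pow U \<subseteq> U" using fin by (auto simp: finite_subset)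
  ultimately have "card (Pow U) \<le> card U" using fin by (rule card_inj_on_le)
  then show False using fin less_exp[of "card U"] by (simp add: card_Pow)
qed

text \<open>AFA for externally finite systems: \<open>T i\<close> gives the indeterminates and
  \<open>B i\<close> the atoms of equation \<open>i\<close>. The work lies in coding the system by
  an element of the model.\<close>

lemma finite_flat_system:
  fixes I :: "nat set"
  assumes I: "finite I" and T: "\<And>i. i \<in> I \<Longrightarrow> T i \<subseteq> I"
    and B: "\<And>i. i \<in> I \<Longrightarrow> finite (B i)" "\<And>i. i \<in> I \<Longrightarrow> B i \<subseteq> U"
  obtains \<sigma> where "\<And>i. i \<in> I \<Longrightarrow> \<sigma> i \<in> U"
    and "\<And>i w. i \<in> I \<Longrightarrow> w \<in> U \<Longrightarrow> mem M w (\<sigma> i) \<longleftrightarrow> w \<in> \<sigma> ` T i \<union> B i"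
proof -
  let ?A = "\<Union>i\<in>I. B i"
  have A: "finite ?A" "?A \<subseteq> U" using I B by auto
  \<comment> \<open>Indeterminates must be disjoint from the atoms; the infinite universe supplies
    them, and injectivity of \<open>h\<close> lets \<open>inv h\<close> read an index back.\<close>
  have "infinite (U - ?A)" using infinite_universe A by (simp add: Diff_infinite_finite)
  then obtain h :: "nat \<Rightarrow> 'a" where h: "inj h" "range h \<subseteq> U - ?A"
    using infinite_countable_subset by blast
  have hU: "h i \<in> U" "h i \<notin> ?A" for i using h(2) by auto
  have h_eq [simp]: "h i = h j \<longleftrightarrow> i = j" for i j using h(1) by (simp add: inj_eq)
  let ?X = "h ` I"
  have X: "finite ?X" "?X \<subseteq> U" using I hU by auto
  define S where "S i = h ` T i \<union> B i" for i
  have S: "finite (S i)" "S i \<subseteq> U" if "i \<in> I" for i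
    using that I T[OF that] B[OF that] hU by (auto simp: S_def finite_subset)
  define g where "g x = fset (S (inv h x))" for x
  have g: "g (h i) = fset (S i)" for i using h(1) by (simp add: g_def)
  have gU: "g ` ?X \<subseteq> U" using S by (auto simp: g)
  let ?S = "fset ((\<lambda>x. pair x (g x)) ` ?X)"
  have SU: "?S \<in> U"
  proof (rule fset_in)
    show "(\<lambda>x. pair x (g x)) ` ?X \<subseteq> U" using X gU by blast
  qed (use X in simp)
  have app: "is_app M ?S x y \<longleftrightarrow> x \<in> ?X \<and> y = g x" if "x \<in> U" "y \<in> U" for x y
    using is_app_fset[OF X gU that] .
  have "is_flat_system M (fset ?X) (fset ?A) ?S"
    unfolding is_flat_system_def
  proof (intro conjI ballI impI)
    show "\<not> (\<exists>z\<in>U. mem M z (fset ?X) \<and> mem M z (fset ?A))"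
      using X A hU by auto
    show "is_fun M ?S (fset ?X)" by (rule is_fun_fset[OF X gU])
  next
    fix x t z assume x: "x \<in> U" "t \<in> U" "z \<in> U"
      and *: "mem M x (fset ?X) \<and> is_app M ?S x t" and z: "mem M z t"
    then obtain i where i: "i \<in> I" "x = h i" "t = fset (S i)" using app X g by auto
    then have "z \<in> S i" using z x S by auto
    then have "z \<in> ?X \<or> z \<in> ?A" using i T by (auto simp: S_def)
    then show "mem M z (fset ?X) \<or> mem M z (fset ?A)" using X A x mem_fset by blast
  qed
  then obtain s where s: "s \<in> U" "is_solution M s (fset ?X) (fset ?A) ?S"
    using AFA[of "fset ?X" "fset ?A" ?S] X A SU fset_in by blast
  then have ex1: "\<exists>!y. y \<in> U \<and> is_app M s (h i) y" if "i \<in> I" for i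
    using that X hU by (auto simp: is_solution_def is_fun_def)
  define \<sigma> where "\<sigma> i = (THE y. y \<in> U \<and> is_app M s (h i) y)" for i
  have \<sigma>: "\<sigma> i \<in> U" "is_app M s (h i) (\<sigma> i)" if "i \<in> I" for i
    using theI'[OF ex1[OF that]] by (auto simp: \<sigma>_def)
  have \<sigma>_eq: "is_app M s (h i) y \<longleftrightarrow> y = \<sigma> i" if "i \<in> I" "y \<in> U" for i y
    using ex1[OF that(1)] \<sigma>[OF that(1)] that by blast
  show ?thesis
  proof (rule that[OF \<sigma>(1)])
    fix i w assume i: "i \<in> I" and w: "w \<in> U"
    have SiU: "fset (S i) \<in> U" using S[OF i] by blast
    have "is_app M ?S (h i) (fset (S i))" using app[OF hU(1) SiU] i g by auto
    then have "mem M w (\<sigma> i) \<longleftrightarrow> (\<exists>y\<in>U. mem M y (fset (S i)) \<and> mem M y (fset ?X) \<and> is_app M s y w)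
        \<or> mem M w (fset (S i)) \<and> mem M w (fset ?A)"
      using s(2) hU(1)[of i] SiU \<sigma>[OF i] w i X unfolding is_solution_def by auto
    also have "\<dots> \<longleftrightarrow> (\<exists>y\<in>S i \<inter> ?X. is_app M s y w) \<or> w \<in> S i \<inter> ?A"
      using S[OF i] X A w by (auto simp: subset_iff)
    \<comment> \<open>By this disjointness the right-hand side splits back into its indeterminates
      and its atoms.\<close>
    also have "S i \<inter> ?X = h ` T i" using T[OF i] hU i by (auto simp: S_def)
    also have "S i \<inter> ?A = B i" using hU i by (auto simp: S_def)
    also have "(\<exists>y\<in>h ` T i. is_app M s y w) \<longleftrightarrow> w \<in> \<sigma> ` T i"
      using T[OF i] \<sigma>_eq w by (auto simp: subset_iff)
    finally show "mem M w (\<sigma> i) \<longleftrightarrow> w \<in> \<sigma> ` T i \<union> B i" by simp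
  qed
qed

text \<open>Solve \<open>x = {y\<^sub>1, \<dots>, y\<^sub>n}\<close>, \<open>y\<^sub>i = {x, c\<^sub>i}\<close>: the distinct atoms \<open>c\<^sub>i\<close> keep the \<open>y\<^sub>i\<close> apart.\<close>

lemma double_degree_attained:
  obtains x where "x \<in> U" and "finite {y \<in> U. mem M x y \<and> mem M y x}"
    and "card {y \<in> U. mem M x y \<and> mem M y x} = n"
proof -
  obtain c :: "nat \<Rightarrow> 'a" where c: "inj c" "range c \<subseteq> U"
    using infinite_countable_subset[OF infinite_universe] by blast
  \<comment> \<open>Index 0 stands for \<open>x\<close>, an index \<open>i\<close> in
    \<open>{1..n}\<close> for the \<open>i\<close>-th member of \<open>x\<close>. For
    \<open>n = 0\<close> the set \<open>\<sigma> 0\<close> is empty.\<close>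
  let ?T = "\<lambda>i. if i = 0 then {1..n} else {0}" and ?B = "\<lambda>i. if i = 0 then {} else {c i}"
  obtain \<sigma> where \<sigma>: "\<And>i. i \<in> {..n} \<Longrightarrow> \<sigma> i \<in> U"
    and mem: "\<And>i w. i \<in> {..n} \<Longrightarrow> w \<in> U \<Longrightarrow> mem M w (\<sigma> i) \<longleftrightarrow> w \<in> \<sigma> ` ?T i \<union> ?B i"
  proof (rule finite_flat_system[of "{..n}" ?T ?B])
    show "finite (?B i)" "?B i \<subseteq> U" for i using c(2) by auto
  qed (auto split: if_splits)
  have mem0: "mem M w (\<sigma> 0) \<longleftrightarrow> w \<in> \<sigma> ` {1..n}" if "w \<in> U" for w
    using mem[of 0 w] that by simp
  have memi: "mem M w (\<sigma> i) \<longleftrightarrow> w = \<sigma> 0 \<or> w = c i" if "i \<in> {1..n}" "w \<in> U" for i w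
    using mem[of i w] that by auto
  have "inj_on \<sigma> {1..n}"
  proof
    fix i j assume ij: "i \<in> {1..n}" "j \<in> {1..n}" "\<sigma> i = \<sigma> j"
    \<comment> \<open>An atom may happen to equal \<open>\<sigma> 0\<close>. If neither disjunction
      gives \<open>c i = c j\<close> directly, both atoms equal \<open>\<sigma> 0\<close> and hence
      each other.\<close>
    have "c i = \<sigma> 0 \<or> c i = c j" "c j = \<sigma> 0 \<or> c j = c i"
      using memi[OF ij(1), of "c i"] memi[OF ij(1), of "c j"]
        memi[OF ij(2), of "c i"] memi[OF ij(2), of "c j"] ij(3) c(2) by auto
    then have "c i = c j" by auto
    then show "i = j" using c(1) by (simp add: inj_eq)
  qed
  \<comment> \<open>Each member of \<open>\<sigma> 0\<close> is some \<open>\<sigma> i\<close>,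
    which contains \<open>\<sigma> 0\<close> in return, so the double neighbours are exactly the
    members.\<close>
  moreover have "{y \<in> U. mem M (\<sigma> 0) y \<and> mem M y (\<sigma> 0)} = \<sigma> ` {1..n}"
    using mem0 memi \<sigma> by fastforce
  ultimately show ?thesis using \<sigma> by (intro that[of "\<sigma> 0"]) (simp_all add: card_image)
qed

end

section \<open>The membership graph\<close>

text \<open>The empty conjunction is a closed truth, so no stray free variable enters.\<close>

definition conj_list :: "'r fm list \<Rightarrow> 'r fm"
  where "conj_list \<phi>s = foldr Conj \<phi>s (Forall (0 \<^bold>= 0))"

lemma sat_conj_list [simp]: "sat M e (conj_list \<phi>s) \<longleftrightarrow> (\<forall>\<phi>\<in>set \<phi>s. sat M e \<phi>)"
  by (induction \<phi>s) (auto simp: conj_list_def)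

lemma fv_conj_list [simp]: "fv (conj_list \<phi>s) = (\<Union>\<phi>\<in>set \<phi>s. fv \<phi>)"
  by (induction \<phi>s) (auto simp: conj_list_def Forall_def)

text \<open>Under the \<open>n\<close> quantifiers the vertex, variable 0 outside, has index
  \<open>n\<close>; the indices below \<open>n\<close> are neighbours, made distinct by comparing
  each \<open>i\<close> with all \<open>j < i\<close>.\<close>

definition double_degree_ge :: "nat \<Rightarrow> graph_sym fm" where
  "double_degree_ge n = Exs n (conj_list (map (\<lambda>i. Rel D n i) [0..<n] @
     [\<^bold>\<not> i \<^bold>= j. i \<leftarrow> [0..<n], j \<leftarrow> [0..<i]]))"

lemma fv_double_degree_ge: "fv (double_degree_ge n) \<subseteq> {0}"
  by (auto simp: double_degree_ge_def fv_Exs)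

text \<open>The quantified neighbours form an injection of \<open>{..<n}\<close> into the
  neighbourhood. Finiteness is assumed because \<open>card\<close> is 0 on infinite sets.\<close>

lemma sat_double_degree_ge:
  assumes "finite {y \<in> universe G. interp G D (e 0) y}"
  shows "sat G e (double_degree_ge n) \<longleftrightarrow> n \<le> card {y \<in> universe G. interp G D (e 0) y}"
    (is "_ \<longleftrightarrow> _ \<le> card ?N")
proof -
  have "sat G e (double_degree_ge n) \<longleftrightarrow> (\<exists>f. f ` {..<n} \<subseteq> ?N \<and> inj_on f {..<n})"
  proof -
    have inj: "inj_on f {..<n} \<longleftrightarrow> (\<forall>i<n. \<forall>j<i. f i \<noteq> f j)" for f :: "nat \<Rightarrow> 'a"
    proof
      assume "inj_on f {..<n}"
      then show "\<forall>i<n. \<forall>j<i. f i \<noteq> f j" by (auto dest: inj_onD)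
    next
      assume *: "\<forall>i<n. \<forall>j<i. f i \<noteq> f j"
      show "inj_on f {..<n}"
      proof (rule inj_onI)
        fix i j assume "i \<in> {..<n}" "j \<in> {..<n}" "f i = f j"
        with * show "i = j" by (cases i j rule: linorder_cases) force+
      qed
    qed
    show ?thesis
      unfolding double_degree_ge_def sat_Exs inj
      by (simp add: ball_Un image_subset_iff ball_conj_distrib lessThan_def conj_assoc
          atLeastLessThan_def)
  qed
  also have "\<dots> \<longleftrightarrow> n \<le> card ?N"
  proof
    assume "\<exists>f. f ` {..<n} \<subseteq> ?N \<and> inj_on f {..<n}"
    then obtain f where "f ` {..<n} \<subseteq> ?N" "inj_on f {..<n}" by blast
    then show "n \<le> card ?N" using card_inj_on_le[of f "{..<n}" ?N] assms by simp
  next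
    assume "n \<le> card ?N"
    with card_le_inj[OF finite_lessThan assms, of n]
    show "\<exists>f. f ` {..<n} \<subseteq> ?N \<and> inj_on f {..<n}" by simp
  qed
  finally show ?thesis .
qed

theorem theorem3:
  fixes M :: "(set_sym, 'a) rel_struct"
  assumes "countable (universe M)"
    and "M \<Turnstile> ZFA"
  shows "\<not> aleph0_categorical (membership_graph M)"
proof -
  interpret ZFA_model M using assms(2) by unfold_locales
  let ?G = "membership_graph M"
  have "\<exists>x. x \<in> universe ?G \<and> finite {y \<in> universe ?G. interp ?G D x y} \<and>
      card {y \<in> universe ?G. interp ?G D x y} = n" for n
  proof -
    obtain x where "x \<in> U" "finite {y \<in> U. mem M x y \<and> mem M y x}"
      "card {y \<in> U. mem M x y \<and> mem M y x} = n"
      by (rule double_degree_attained)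
    then show ?thesis by (intro exI[of _ x]) (simp add: membership_graph_def)
  qed
  then obtain a where a: "\<And>n. a n \<in> universe ?G"
    and fin: "\<And>n. finite {y \<in> universe ?G. interp ?G D (a n) y}"
    and card: "\<And>n. card {y \<in> universe ?G. interp ?G D (a n) y} = n"
    by metis
  \<comment> \<open>The formula serving as \<open>\<gamma> n\<close> says "at most \<open>n\<close>
    double neighbours". It holds at exactly \<open>a 0\<close> to \<open>a n\<close>, and its
    negations make the limit type demand infinitely many double neighbours.\<close>
  have sat: "sat ?G (\<lambda>_. a m) (Neg (double_degree_ge (Suc n))) \<longleftrightarrow> m \<le> n" for m n
    using sat_double_degree_ge[of ?G "\<lambda>_. a m" "Suc n"] fin card by auto
  show ?thesis
  proof (rule not_aleph0_categorical[OF a])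
    show "fv (Neg (double_degree_ge (Suc n))) \<subseteq> {0}" for n using fv_double_degree_ge by simp
    show "sat ?G (\<lambda>_. a n) (Neg (double_degree_ge (Suc n)))" for n by (simp only: sat)
    show "finite {m. sat ?G (\<lambda>_. a m) (Neg (double_degree_ge (Suc n)))}" for n
      by (simp only: sat) simp
  qed
qed

end
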